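(* Let $\mathcal{C}_1\subseteq\mathbb{F}_{q^m}^n$ be a linear code, $\mathcal{C}_2\subsetneqq\mathcal{C}_1$ a subcode with $\dim\mathcal{C}_2=\dim\mathcal{C}_1-l$, $l\ge 1$, and $\psi:\mathbb{F}_{q^m}^l\to\mathcal{C}_1/\mathcal{C}_2$ a linear bijection. Let $(S,X)$ be random variables with an arbitrary joint distribution $P_{S,X}$ such that $S\in\mathbb{F}_{q^m}^l$ and $X\in\psi(S)$. For $0\le\mu\le n$ let $\Theta_{\mu,P_{S,X}}=\min_{B\in\mathbb{F}_q^{\mu\times n}}H(S|BX^{\rm T})$ be the universal equivocation. Then $$H(S)-D(X\|U_{\psi(S)}|S)-K_{R,\mu}(\mathcal{C}_2^\perp,\mathcal{C}_1^\perp)\ \le\ \Theta_{\mu,P_{S,X}}\ \le\ l-K_{R,\mu}(\mathcal{C}_2^\perp,\mathcal{C}_1^\perp).$$ When $S$ and $X$ are uniformly distributed over $\mathbb{F}_{q^m}^l$ and $\mathcal{C}_1$ respectively, $\Theta_{\mu,P_{S,X}}=l-K_{R,\mu}(\mathcal{C}_2^\perp,\mathcal{C}_1^\perp)$.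
   Context: $\mathbb{F}_{q^m}$ is the degree-$m$ extension ($m\ge1$) of the finite field $\mathbb{F}_q$. Linear codes are $\mathbb{F}_{q^m}$-subspaces of the row space $\mathbb{F}_{q^m}^n$; dimensions are over $\mathbb{F}_{q^m}$; $\mathcal{C}^\perp$ is the dual code for the standard bilinear form. For a subspace $V\subseteq\mathbb{F}_{q^m}^n$ put $V^q=\{[v_1^q,\dots,v_n^q]: v\in V\}$. Let $\Gamma(\mathbb{F}_{q^m}^n)$ be the set of $\mathbb{F}_{q^m}$-subspaces $V\subseteq\mathbb{F}_{q^m}^n$ with $V=V^q$, and $\Gamma_i(\mathbb{F}_{q^m}^n)$ those of dimension $i$. For codes $\mathcal{D}_2\subsetneqq\mathcal{D}_1\subseteq\mathbb{F}_{q^m}^n$ and $0\le i\le n$, the $i$-th relative dimension/intersection profile (RDIP) is $K_{R,i}(\mathcal{D}_1,\mathcal{D}_2)=\max_{V\in\Gamma_i(\mathbb{F}_{q^m}^n)}\{\dim(\mathcal{D}_1\cap V)-\dim(\mathcal{D}_2\cap V)\}$. All entropies $H$ and relative entropies $D$ use logarithms to base $q^m$. $D(X\|U_{\psi(S)}|S)=\sum_s P_S(s)\,D(P_{X|S=s}\,\|\,\text{uniform distribution on the coset }\psi(s))$. *)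

theory Defs
  imports "HOL-Probability.Probability" "HOL-Library.Set_Algebras"
begin

definition is_subfield :: "'a::field set \<Rightarrow> bool" where
  "is_subfield K \<longleftrightarrow> 0 \<in> K \<and> 1 \<in> K
     \<and> (\<forall>x\<in>K. \<forall>y\<in>K. x - y \<in> K \<and> x * y \<in> K)
     \<and> (\<forall>x\<in>K. inverse x \<in> K)"

definition dual_code :: "('a::field ^ 'n) set \<Rightarrow> ('a ^ 'n) set" where
  "dual_code C = {y. \<forall>x\<in>C. scalar_product x y = 0}"

definition frob_image :: "nat \<Rightarrow> ('a::field ^ 'n) set \<Rightarrow> ('a ^ 'n) set" where
  "frob_image q V = (\<lambda>v. \<chi> i. (v $ i) ^ q) ` V"

definition Gamma_frob :: "nat \<Rightarrow> ('a::field ^ 'n) set set" where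
  "Gamma_frob q = {V. vec.subspace V \<and> V = frob_image q V}"

definition Gamma_frob_dim :: "nat \<Rightarrow> nat \<Rightarrow> ('a::field ^ 'n) set set" where
  "Gamma_frob_dim q i = {V \<in> Gamma_frob q. vec.dim V = i}"

(* Integer-valued so that the difference of dimensions is not truncated.
   Meaningful for i \<le> CARD('n) over a finite field, where the set is finite and nonempty. *)
definition RDIP :: "nat \<Rightarrow> nat \<Rightarrow> ('a::field ^ 'n) set \<Rightarrow> ('a ^ 'n) set \<Rightarrow> int" where
  "RDIP q i D1 D2 =
     Max ((\<lambda>V. int (vec.dim (D1 \<inter> V)) - int (vec.dim (D2 \<inter> V))) ` Gamma_frob_dim q i)"

(* The quotient of C by its subspace W, as the set of cosets x + W with x in C.
   Addition in it is addition of sets. *)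
definition quotient_space :: "('a::field ^ 'n) set \<Rightarrow> ('a ^ 'n) set \<Rightarrow> ('a ^ 'n) set set" where
  "quotient_space C W = (\<lambda>x. x +o W) ` C"

(* a (x + W) = a x + W; adding W back is needed because for a = 0 the image alone is {0}. *)
definition coset_scale :: "('a::field ^ 'n) set \<Rightarrow> 'a \<Rightarrow> ('a ^ 'n) set \<Rightarrow> ('a ^ 'n) set" where
  "coset_scale W a A = (\<lambda>x. a *s x) ` A + W"

definition linear_bij_quotient ::
    "('a::field ^ 'n) set \<Rightarrow> ('a ^ 'n) set \<Rightarrow> ('a ^ 'l \<Rightarrow> ('a ^ 'n) set) \<Rightarrow> bool" where
  "linear_bij_quotient C W \<psi> \<longleftrightarrow>
     bij_betw \<psi> UNIV (quotient_space C W)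
     \<and> (\<forall>s t. \<psi> (s + t) = \<psi> s + \<psi> t)
     \<and> (\<forall>a s. \<psi> (a *s s) = coset_scale W a (\<psi> s))"

(* Shannon entropy to base b of random variables with finite range; these are the
   notations H(X) and H(X|Y) of the locale information_space. *)
abbreviation Ent :: "real \<Rightarrow> 'w measure \<Rightarrow> ('w \<Rightarrow> 'b) \<Rightarrow> real" where
  "Ent b M X \<equiv> prob_space.entropy M b (count_space (X ` space M)) X"

abbreviation cond_Ent :: "real \<Rightarrow> 'w measure \<Rightarrow> ('w \<Rightarrow> 'b) \<Rightarrow> ('w \<Rightarrow> 'c) \<Rightarrow> real" where
  "cond_Ent b M X Y \<equiv>
     prob_space.conditional_entropy M b (count_space (X ` space M)) (count_space (Y ` space M)) X Y"

abbreviation uniform_on :: "'b set \<Rightarrow> 'b measure" where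
  "uniform_on A \<equiv> uniform_measure (count_space UNIV) A"

(* D(X || U_psi(S) | S). The library's KL_divergence b Q P is D(P || Q).  Conditioning on
   S = s is uniform_measure M {S = s}; for P(S = s) = 0 the summand vanishes. *)
definition cond_divergence_uniform ::
    "real \<Rightarrow> 'w measure \<Rightarrow> ('w \<Rightarrow> 's::finite) \<Rightarrow> ('w \<Rightarrow> 'x) \<Rightarrow> ('s \<Rightarrow> 'x set) \<Rightarrow> real" where
  "cond_divergence_uniform b M S X \<psi> =
     (\<Sum>s\<in>UNIV. measure M (S -` {s} \<inter> space M) *
        KL_divergence b (uniform_on (\<psi> s))
          (distr (uniform_measure M (S -` {s} \<inter> space M)) (count_space UNIV) X))"

(* Matrices with \<mu> rows (possibly \<mu> = 0) and columns indexed by 'n are lists of rows. *)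
definition matrices_over :: "'a set \<Rightarrow> nat \<Rightarrow> ('a ^ 'n) list set" where
  "matrices_over K \<mu> = {B. length B = \<mu> \<and> (\<forall>r\<in>set B. \<forall>j. r $ j \<in> K)}"

definition rows_mult :: "('a::field ^ 'n) list \<Rightarrow> 'a ^ 'n \<Rightarrow> 'a list" where
  "rows_mult B x = map (\<lambda>r. scalar_product r x) B"

definition universal_equivocation ::
    "real \<Rightarrow> 'w measure \<Rightarrow> 'a::field set \<Rightarrow> nat \<Rightarrow> ('w \<Rightarrow> 's) \<Rightarrow> ('w \<Rightarrow> 'a ^ 'n) \<Rightarrow> real" where
  "universal_equivocation b M K \<mu> S X =
     Min ((\<lambda>B. cond_Ent b M S (\<lambda>\<omega>. rows_mult B (X \<omega>))) ` matrices_over K \<mu>)"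

end

theory Submission
  imports Defs
begin

text \<open>
  For a matrix \<open>B\<close> over \<open>F\<^sub>q\<close> with row space \<open>V\<close>, counting along the fibres of \<open>x \<mapsto> B x\<^sup>T\<close> and along
  the pairing of \<open>D\<close> with \<open>V\<close> gives \<open>|D| |V \<inter> D\<^sup>\<bottom>| = |V| |D \<inter> V\<^sup>\<bottom>|\<close>. Put
  \<open>\<kappa> = dim (C\<^sub>2\<^sup>\<bottom> \<inter> V) - dim (C\<^sub>1\<^sup>\<bottom> \<inter> V)\<close>. Each value of \<open>B X\<^sup>T\<close> is then compatible with at most
  \<open>(q\<^sup>m)\<^bsup>l - \<kappa>\<^esup>\<close> values of \<open>S\<close>, so \<open>H(S|BX\<^sup>T) \<le> l - \<kappa>\<close>, while \<open>ln z \<le> z - 1\<close> applied to the joint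
  distribution of \<open>(S, X)\<close> gives \<open>H(S|BX\<^sup>T) \<ge> H(S) - D - \<kappa>\<close>. Finally \<open>\<kappa>\<close> is monotone in \<open>V\<close>, and a
  subspace is fixed by the Frobenius map iff it is spanned by vectors over \<open>F\<^sub>q\<close>, so the largest
  \<open>\<kappa>\<close> over all \<open>B\<close> is the RDIP.
\<close>

subsection \<open>Frobenius-invariant subspaces\<close>

text \<open>Multiplication by a nonzero \<open>x\<close> permutes \<open>K - {0}\<close>. Comparing
  the product of all elements before and after gives \<open>x ^ card ?U = 1\<close>.\<close>

lemma subfield_power_card:
  fixes K :: "'a::{field,finite} set"
  assumes K: "is_subfield K" and x: "x \<in> K"
  shows "x ^ card K = x"
proof (cases "x = 0")
  case True
  with x have "card K > 0" by (auto simp: card_gt_0_iff)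
  with True show ?thesis by simp
next
  case False
  let ?U = "K - {0}"
  have im: "(*) x ` ?U = ?U"
  proof (rule card_subset_eq)
    show "(*) x ` ?U \<subseteq> ?U" using K x False by (auto simp: is_subfield_def)
    show "card ((*) x ` ?U) = card ?U"
      using False by (intro card_image) (auto simp: inj_on_def)
  qed simp
  have "\<Prod>?U = (\<Prod>y\<in>?U. x * y)"
    by (subst im[symmetric], subst prod.reindex) (use False in \<open>auto simp: inj_on_def\<close>)
  also have "\<dots> = x ^ card ?U * \<Prod>?U" by (simp add: prod.distrib)
  finally have "x ^ card ?U = 1" by simp
  moreover have "card K = Suc (card ?U)"
    using K card.remove[of K 0] by (simp add: is_subfield_def)
  ultimately show ?thesis by simp
qed

text \<open>Additivity of \<open>x \<mapsto> x ^ q\<close>: the polynomial \<open>(X + a) ^ q - X ^ q - a ^ q\<close> has degree below \<open>q\<close>,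
  so it is zero as soon as it vanishes on \<open>K\<close>. This holds first for \<open>a \<in> K\<close>, hence, exchanging
  the summands, for every \<open>a\<close>.\<close>

lemma subfield_frobenius_add:
  fixes K :: "'a::{field,finite} set" and x y :: 'a
  assumes K: "is_subfield K"
  shows "(x + y) ^ card K = x ^ card K + y ^ card K"
proof -
  let ?q = "card K"
  have "0 \<in> K" using K by (simp add: is_subfield_def)
  then have q: "?q > 0" by (auto simp: card_gt_0_iff)
  have add_K: "a + b \<in> K" if "a \<in> K" "b \<in> K" for a b
  proof -
    have "a - (0 - b) \<in> K" using K that unfolding is_subfield_def by blast
    then show ?thesis by simp
  qed
  have extend: "(z + a) ^ ?q = z ^ ?q + a ^ ?q"
    if van: "\<And>u. u \<in> K \<Longrightarrow> (u + a) ^ ?q = u ^ ?q + a ^ ?q" for a z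
  proof -
    define P where "P = [:a, 1:] ^ ?q - monom 1 ?q - [:a ^ ?q:]"
    have poly_P: "poly P u = (u + a) ^ ?q - u ^ ?q - a ^ ?q" for u
      by (simp add: P_def poly_monom add.commute)
    have "P = 0"
    proof (rule ccontr)
      assume "P \<noteq> 0"
      have "degree P \<le> ?q"
        unfolding P_def by (intro degree_diff_le) (simp_all add: degree_linear_power degree_monom_le)
      \<comment> \<open>The leading terms of \<open>[:a, 1:] ^ ?q\<close> and
        \<open>monom 1 ?q\<close> cancel, and the constant sits in degree 0, which is below
        \<open>?q\<close>.\<close>
      moreover have "coeff P ?q = 0"
        using \<open>0 \<in> K\<close> by (auto simp: P_def coeff_linear_power coeff_pCons split: nat.split)
      ultimately have "degree P < ?q"
        using \<open>P \<noteq> 0\<close> by (metis le_neq_implies_less leading_coeff_0_iff)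
      moreover have "?q \<le> card {u. poly P u = 0}"
        using van by (intro card_mono) (auto simp: poly_P)
      moreover have "card {u. poly P u = 0} \<le> degree P"
        using \<open>P \<noteq> 0\<close> by (rule card_poly_roots_bound)
      ultimately show False by simp
    qed
    then show ?thesis using poly_P[of z] by (simp add: diff_eq_eq add.commute)
  qed
  have "(u + a) ^ ?q = u ^ ?q + a ^ ?q" if "a \<in> K" for u a
    by (rule extend) (use that K add_K in \<open>simp add: subfield_power_card\<close>)
  then have "(u + y) ^ ?q = u ^ ?q + y ^ ?q" if "u \<in> K" for u
    using that by (metis add.commute)
  then show ?thesis by (rule extend)
qed

lemma subfield_frobenius_diff:
  fixes K :: "'a::{field,finite} set" and x y :: 'a
  assumes "is_subfield K"
  shows "(x - y) ^ card K = x ^ card K - y ^ card K"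
  using subfield_frobenius_add[OF assms, of "x - y" y] by simp

text \<open>The polynomial \<open>X ^ card K - X\<close> has at most \<open>card K\<close> roots,
  and all elements of \<open>K\<close> are among them.\<close>

lemma subfield_eq_fixed_points:
  fixes K :: "'a::{field,finite} set"
  assumes K: "is_subfield K"
  shows "K = {x. x ^ card K = x}"
proof (rule card_subset_eq)
  show "K \<subseteq> {x. x ^ card K = x}" using subfield_power_card[OF K] by blast
  then have le: "card K \<le> card {x :: 'a. x ^ card K = x}" by (rule card_mono[rotated]) simp
  have "{0, 1} \<subseteq> K" using K by (simp add: is_subfield_def)
  then have "card {0, 1 :: 'a} \<le> card K" by (intro card_mono) auto
  \<comment> \<open>This keeps \<open>monom 1 1\<close> strictly below the leading term, so
    \<open>P\<close> cannot vanish.\<close>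
  then have q: "card K \<ge> 2" by simp
  define P :: "'a poly" where "P = monom 1 (card K) - monom 1 1"
  have "coeff P (card K) = 1" using q by (simp add: P_def)
  then have "P \<noteq> 0" by auto
  then have "card {x. poly P x = 0} \<le> degree P" by (rule card_poly_roots_bound)
  also have "degree P \<le> card K"
    unfolding P_def using q by (intro degree_diff_le) (simp_all add: degree_monom_eq)
  finally show "card K = card {x :: 'a. x ^ card K = x}" using le by (simp add: P_def poly_monom)
qed simp

text \<open>Galois descent: a nonzero vector \<open>w\<close> of \<open>V\<close> of minimal support, normalised to have an entry \<open>1\<close>,
  is fixed by the Frobenius map, since the support of its image minus \<open>w\<close> is strictly smaller.
  Clearing that entry reduces to a smaller subspace.\<close>

lemma Gamma_frob_rational_span:
  fixes K :: "'a::{field,finite} set" and V :: "('a ^ 'n::finite) set"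
  assumes K: "is_subfield K" and V: "V \<in> Gamma_frob (card K)"
  shows "vec.span (V \<inter> {v. \<forall>j. v $ j \<in> K}) = V"
proof -
  let ?R = "{v :: 'a ^ 'n. \<forall>j. v $ j \<in> K}"
  let ?F = "\<lambda>v :: 'a ^ 'n. \<chi> i. (v $ i) ^ card K"
  define supp :: "'a ^ 'n \<Rightarrow> 'n set" where "supp v = {j. v $ j \<noteq> 0}" for v
  have "0 \<in> K" using K by (simp add: is_subfield_def)
  then have q: "card K > 0" by (auto simp: card_gt_0_iff)
  \<comment> \<open>The induction assumes only that \<open>?F\<close> maps \<open>W\<close> into
    itself, a property that passes at once to the section \<open>W'\<close> below.\<close>
  have "W \<subseteq> vec.span (W \<inter> ?R)" if "vec.subspace W" "?F ` W \<subseteq> W" for W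
    using that
  proof (induction "card W" arbitrary: W rule: less_induct)
    case less
    note sub = less.prems(1)
    show ?case
    proof (cases "W \<subseteq> {0}")
      case True
      then show ?thesis by (auto simp: vec.span_zero)
    next
      case False
      then have "\<exists>v. v \<in> W - {0}" by blast
      then obtain v where v: "v \<in> W - {0}"
        and min: "\<And>w. w \<in> W - {0} \<Longrightarrow> card (supp v) \<le> card (supp w)"
        using exists_least_iff[of "\<lambda>k. \<exists>v \<in> W - {0}. card (supp v) = k"]
        by (metis linorder_not_le)
      from v obtain i where i: "v $ i \<noteq> 0" by (auto simp: vec_eq_iff)
      define w where "w = inverse (v $ i) *s v"
      have w: "w \<in> W" "w $ i = 1" "supp w = supp v"
        using v i sub by (auto simp: w_def supp_def vec.subspace_scale)
      have "?F w - w \<in> W" using less.prems w(1) by (blast intro: vec.subspace_diff)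
      \<comment> \<open>The entry 1 at \<open>i\<close> is fixed by the power map and cancels; zero
        entries stay zero because the exponent is positive.\<close>
      moreover have "i \<in> supp w" "i \<notin> supp (?F w - w)" "supp (?F w - w) \<subseteq> supp w"
        using w(2) q by (auto simp: supp_def)
      then have "supp (?F w - w) \<subset> supp v" using w(3) by blast
      then have "card (supp (?F w - w)) < card (supp v)" by (intro psubset_card_mono) auto
      ultimately have "?F w - w = 0" using min by (metis DiffI linorder_not_le singletonD)
      then have wR: "w \<in> ?R"
        using subfield_eq_fixed_points[OF K] by (auto simp: vec_eq_iff)
      define W' where "W' = {u \<in> W. u $ i = 0}"
      have "vec.subspace W'"
        using sub by (auto simp: vec.subspace_def W'_def)
      moreover have "?F ` W' \<subseteq> W'" using less.prems(2) q by (auto simp: W'_def)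
      moreover have "w \<notin> W'" "W' \<subseteq> W" using w(2) by (auto simp: W'_def)
      then have "W' \<subset> W" using w(1) by blast
      then have "card W' < card W" by (intro psubset_card_mono) auto
      ultimately have IH: "W' \<subseteq> vec.span (W' \<inter> ?R)" using less.hyps by blast
      show ?thesis
      proof
        fix u assume u: "u \<in> W"
        have "u - (u $ i) *s w \<in> W'"
          using u w sub by (auto simp: W'_def intro: vec.subspace_diff vec.subspace_scale)
        with IH have "u - (u $ i) *s w \<in> vec.span (W' \<inter> ?R)" by blast
        then have "u - (u $ i) *s w \<in> vec.span (W \<inter> ?R)"
          using vec.span_mono[of "W' \<inter> ?R" "W \<inter> ?R"] by (auto simp: W'_def)
        moreover have "(u $ i) *s w \<in> vec.span (W \<inter> ?R)"
          using w(1) wR by (intro vec.span_scale vec.span_base) auto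
        ultimately have "(u - (u $ i) *s w) + (u $ i) *s w \<in> vec.span (W \<inter> ?R)"
          by (rule vec.span_add)
        then show "u \<in> vec.span (W \<inter> ?R)" by simp
      qed
    qed
  qed
  from this[of V] have "V \<subseteq> vec.span (V \<inter> ?R)"
    using V by (auto simp: Gamma_frob_def frob_image_def)
  moreover have "vec.span (V \<inter> ?R) \<subseteq> V"
    using V by (intro vec.span_minimal) (auto simp: Gamma_frob_def)
  ultimately show ?thesis by blast
qed

text \<open>The vectors that \<open>?F\<close> sends into the span form a subspace, since
  \<open>?F\<close> is additive and turns the scalar \<open>c\<close> into
  \<open>c ^ card K\<close>. This subspace contains \<open>B\<close>, whose members are fixed by
  \<open>?F\<close>. Equality follows because an injective self-map of a finite set is onto.\<close>

lemma span_rational_Gamma_frob: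
  fixes K :: "'a::{field,finite} set" and B :: "('a ^ 'n::finite) set"
  assumes K: "is_subfield K" and B: "\<And>v j. v \<in> B \<Longrightarrow> v $ j \<in> K"
  shows "vec.span B \<in> Gamma_frob (card K)"
proof -
  let ?F = "\<lambda>v :: 'a ^ 'n. \<chi> i. (v $ i) ^ card K"
  have "0 \<in> K" using K by (simp add: is_subfield_def)
  then have q: "card K > 0" by (auto simp: card_gt_0_iff)
  have "vec.subspace {v. ?F v \<in> vec.span B}"
  proof (rule vec.subspaceI)
    have "?F 0 = 0" using q by (simp add: vec_eq_iff)
    then show "0 \<in> {v. ?F v \<in> vec.span B}" by (simp add: vec.span_zero)
  next
    fix u v assume "u \<in> {v. ?F v \<in> vec.span B}" "v \<in> {v. ?F v \<in> vec.span B}"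
    moreover have "?F (u + v) = ?F u + ?F v"
      by (simp add: vec_eq_iff subfield_frobenius_add[OF K])
    ultimately show "u + v \<in> {v. ?F v \<in> vec.span B}" by (simp add: vec.span_add)
  next
    fix c u assume "u \<in> {v. ?F v \<in> vec.span B}"
    moreover have "?F (c *s u) = (c ^ card K) *s ?F u"
      by (simp add: vec_eq_iff power_mult_distrib)
    ultimately show "c *s u \<in> {v. ?F v \<in> vec.span B}" by (simp add: vec.span_scale)
  qed
  moreover have "B \<subseteq> {v. ?F v \<in> vec.span B}"
  proof
    fix v assume v: "v \<in> B"
    then have "?F v = v" by (simp add: vec_eq_iff B K subfield_power_card)
    then show "v \<in> {v. ?F v \<in> vec.span B}" using v by (simp add: vec.span_base)
  qed
  ultimately have "vec.span B \<subseteq> {v. ?F v \<in> vec.span B}" by (intro vec.span_minimal)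
  then have "?F ` vec.span B \<subseteq> vec.span B" by blast
  moreover have "inj ?F"
  proof (rule injI)
    fix u v assume "?F u = ?F v"
    then have "\<forall>i. (u $ i - v $ i) ^ card K = 0"
      by (simp add: vec_eq_iff subfield_frobenius_diff[OF K])
    then show "u = v" by (simp add: vec_eq_iff)
  qed
  ultimately have "?F ` vec.span B = vec.span B"
    by (intro endo_inj_surj) (auto intro: inj_on_subset)
  then show ?thesis by (simp add: Gamma_frob_def frob_image_def)
qed

text \<open>The rows may be dependent, so their span can have dimension below \<open>i\<close>. A
  maximal independent set of rows is enlarged by further rational vectors to exactly
  \<open>i\<close> members, which is possible as \<open>i \<le> CARD('n)\<close>.\<close>

lemma rational_rows_in_Gamma_frob_dim:
  fixes K :: "'a::{field,finite} set" and B :: "('a ^ 'n::finite) list"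
  assumes K: "is_subfield K" and B: "B \<in> matrices_over K i" and i: "i \<le> CARD('n)"
  obtains V where "V \<in> Gamma_frob_dim (card K) i" "vec.span (set B) \<subseteq> V"
proof -
  let ?R = "{v :: 'a ^ 'n. \<forall>j. v $ j \<in> K}"
  have BR: "set B \<subseteq> ?R" and len: "length B = i" using B by (auto simp: matrices_over_def)
  obtain B0 where B0: "B0 \<subseteq> set B" "vec.independent B0" "set B \<subseteq> vec.span B0"
    using vec.maximal_independent_subset[of "set B"] by metis
  obtain B1 where B1: "B0 \<subseteq> B1" "B1 \<subseteq> ?R" "vec.independent B1" "?R \<subseteq> vec.span B1"
    using vec.maximal_independent_subset_extend[of B0 ?R] B0 BR by blast
  \<comment> \<open>The unit vectors are rational, so the rational independent set \<open>B1\<close>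
    spans the whole space and has \<open>CARD('n)\<close> members.\<close>
  have "cart_basis \<subseteq> ?R" using K by (auto simp: cart_basis_def axis_def is_subfield_def)
  with B1(4) have "vec.span cart_basis \<subseteq> vec.span B1"
    by (intro vec.span_minimal) auto
  then have "vec.span B1 = UNIV" by auto
  then have card_B1: "card B1 = CARD('n)"
    using vec.dim_eq_card_independent[OF B1(3)] by (metis vec.dim_span vec_dim_card)
  have "card B0 \<le> i" using B0(1) len card_mono[OF _ B0(1)] card_length[of B] by simp
  then obtain B2 where B2: "B0 \<subseteq> B2" "B2 \<subseteq> B1" "card B2 = i"
    using exists_subset_between[of B0 i B1] B1(1) card_B1 i by auto
  have "vec.span B2 \<in> Gamma_frob (card K)"
    using B1(2) B2(2) by (intro span_rational_Gamma_frob[OF K]) auto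
  moreover have "vec.dim (vec.span B2) = i"
    using B2 vec.independent_mono[OF B1(3) B2(2)] by (simp add: vec.dim_eq_card_independent)
  moreover have "vec.span (set B) \<subseteq> vec.span B2"
    using B0(3) vec.span_mono[OF B2(1)] by (intro vec.span_minimal) auto
  ultimately show ?thesis using that[of "vec.span B2"] unfolding Gamma_frob_dim_def by blast
qed

text \<open>Descent makes the rational vectors of \<open>V\<close> a spanning set; a basis chosen
  among them, listed without repetition, is the matrix.\<close>

lemma Gamma_frob_dim_rational_rows:
  fixes K :: "'a::{field,finite} set" and V :: "('a ^ 'n::finite) set"
  assumes K: "is_subfield K" and V: "V \<in> Gamma_frob_dim (card K) i"
  obtains B where "B \<in> matrices_over K i" "vec.span (set B) = V"
proof -
  let ?G = "V \<inter> {v. \<forall>j. v $ j \<in> K}"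
  have span: "vec.span ?G = V" and dim: "vec.dim V = i"
    using V Gamma_frob_rational_span[OF K] by (auto simp: Gamma_frob_dim_def)
  obtain B0 where B0: "B0 \<subseteq> ?G" "vec.independent B0" "?G \<subseteq> vec.span B0"
    using vec.maximal_independent_subset[of ?G] by metis
  have "vec.span B0 = V"
    using vec.span_minimal[OF B0(3)] vec.span_mono[OF B0(1)] span by auto
  moreover from this have "card B0 = i"
    using vec.dim_eq_card_independent[OF B0(2)] dim by (metis vec.dim_span)
  moreover obtain B where "set B = B0" "distinct B" using finite_distinct_list[of B0] by auto
  ultimately show ?thesis
    using that[of B] B0(1) by (fastforce simp: matrices_over_def distinct_card)
qed

subsection \<open>Counting in subspaces and their duals\<close>

text \<open>A further independent vector \<open>b\<close> multiplies the count by
  \<open>CARD('a)\<close>, since the coefficient of \<open>b\<close> and the remaining part in the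
  old span are unique.\<close>

lemma card_span_independent:
  fixes B :: "('a::{field,finite} ^ 'n::finite) set"
  assumes "vec.independent B"
  shows "card (vec.span B) = CARD('a) ^ card B"
proof -
  have "finite B" by simp
  then show ?thesis using assms
  proof (induction B rule: finite_induct)
    case empty
    then show ?case by simp
  next
    case (insert b B)
    then have ind: "vec.independent B" and b: "b \<notin> vec.span B"
      by (auto simp: vec.independent_insert)
    let ?g = "\<lambda>(k, x). k *s b + x"
    have "vec.span (insert b B) = ?g ` (UNIV \<times> vec.span B)"
    proof (intro equalityI subsetI)
      fix x assume "x \<in> vec.span (insert b B)"
      then obtain k where "x - k *s b \<in> vec.span B" by (auto simp: vec.span_insert)
      then show "x \<in> ?g ` (UNIV \<times> vec.span B)"
        by (intro image_eqI[of _ _ "(k, x - k *s b)"]) auto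
    next
      fix x assume "x \<in> ?g ` (UNIV \<times> vec.span B)"
      then obtain k y where "x = k *s b + y" "y \<in> vec.span B" by auto
      then show "x \<in> vec.span (insert b B)"
        by (auto simp: vec.span_insert intro!: exI[of _ k])
    qed
    moreover have "inj_on ?g (UNIV \<times> vec.span B)"
    proof (rule inj_onI, clarsimp)
      fix k x k' x' assume x: "x \<in> vec.span B" "x' \<in> vec.span B" and eq: "k *s b + x = k' *s b + x'"
      then have "(k - k') *s b = x' - x" by (simp add: vec.scale_left_diff_distrib algebra_simps)
      also have "\<dots> \<in> vec.span B" using x by (simp add: vec.span_diff)
      finally have "(k - k') *s b \<in> vec.span B" .
      \<comment> \<open>If the coefficients differed, dividing by their difference would put
        \<open>b\<close> into the span of \<open>B\<close>.\<close>
      then have "k = k'"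
        using b vec.span_scale[of "(k - k') *s b" B "inverse (k - k')"] vec.scale_scale[of "inverse (k - k')" "k - k'" b]
        by (cases "k = k'") (simp_all del: vec.scale_left_diff_distrib)
      with eq show "k = k' \<and> x = x'" by simp
    qed
    ultimately show ?case
      using insert ind by (simp add: card_image card_cartesian_product)
  qed
qed

lemma card_subspace:
  fixes V :: "('a::{field,finite} ^ 'n::finite) set"
  assumes "vec.subspace V"
  shows "card V = CARD('a) ^ vec.dim V"
proof -
  obtain B where B: "B \<subseteq> V" "vec.independent B" "V \<subseteq> vec.span B" "card B = vec.dim V"
    by (rule vec.basis_exists)
  then have "vec.span B = V" using assms vec.span_subspace by metis
  with B show ?thesis using card_span_independent by metis
qed

text \<open>The fibre through \<open>x\<close> is the translate of \<open>D \<inter> U\<close> by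
  \<open>x\<close>. Hypothesis \<open>eq\<close> replaces linearity of \<open>f\<close> with kernel
  \<open>U\<close>, so that \<open>f\<close> may take values in lists or restricted
  functions.\<close>

lemma card_coset_fiber:
  fixes D U :: "('a::{field,finite} ^ 'n::finite) set"
  assumes D: "vec.subspace D" and eq: "\<And>x y. f x = f y \<longleftrightarrow> x - y \<in> U" and x: "x \<in> a +o D"
  shows "card {y \<in> a +o D. f y = f x} = card (D \<inter> U)"
proof -
  obtain d where d: "x = a + d" "d \<in> D" using x by (auto simp: elt_set_plus_def)
  have "{y \<in> a +o D. f y = f x} = (+) x ` (D \<inter> U)"
  proof (intro equalityI subsetI)
    fix y assume y: "y \<in> {y \<in> a +o D. f y = f x}"
    then obtain e where "y = a + e" "e \<in> D" by (auto simp: elt_set_plus_def)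
    then have "y - x \<in> D" using D d by (simp add: vec.subspace_diff)
    moreover have "y - x \<in> U" "y = x + (y - x)" using eq y by auto
    ultimately show "y \<in> (+) x ` (D \<inter> U)" by blast
  next
    fix y assume "y \<in> (+) x ` (D \<inter> U)"
    then obtain k where k: "y = x + k" "k \<in> D" "k \<in> U" by blast
    then have "y = a + (d + k)" "d + k \<in> D" using D d by (simp_all add: vec.subspace_add add.assoc)
    then show "y \<in> {y \<in> a +o D. f y = f x}" using eq k by (auto simp: elt_set_plus_def)
  qed
  then show ?thesis by (simp add: card_image)
qed

text \<open>Rank-nullity in terms of cardinalities: all nonempty fibres on \<open>D\<close> have the
  same size.\<close>

lemma card_eq_card_image_mult:
  fixes D U :: "('a::{field,finite} ^ 'n::finite) set"
  assumes D: "vec.subspace D" and eq: "\<And>x y. f x = f y \<longleftrightarrow> x - y \<in> U"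
  shows "card D = card (f ` D) * card (D \<inter> U)"
proof -
  have "card D = (\<Sum>z\<in>f ` D. card {y \<in> D. f y = z})"
    using sum.image_gen[of D "\<lambda>_. 1::nat" f] by simp
  also have "\<dots> = (\<Sum>z\<in>f ` D. card (D \<inter> U))"
    using card_coset_fiber[OF D eq, where a = 0] by (intro sum.cong) auto
  finally show ?thesis by simp
qed

section \<open>Orthogonality and dual codes\<close>

lemma scalar_product_commute:
  fixes x y :: "'a::field ^ 'n"
  shows "scalar_product x y = scalar_product y x"
  by (simp add: scalar_product_def mult.commute)

lemma subspace_scalar_product_eq_0:
  fixes x :: "'a::field ^ 'n::finite"
  shows "vec.subspace {y. scalar_product x y = 0}"
  by (rule vec.subspaceI)
    (simp_all add: scalar_product_def distrib_left sum.distrib mult.left_commute[of _ "_::'a"]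
      flip: sum_distrib_left)

lemma scalar_product_diff_right:
  fixes x y z :: "'a::field ^ 'n::finite"
  shows "scalar_product x (y - z) = scalar_product x y - scalar_product x z"
  by (simp add: scalar_product_def right_diff_distrib sum_subtractf)

lemma subspace_dual_code: "vec.subspace (dual_code D)" for D :: "('a::field ^ 'n::finite) set"
proof -
  have "dual_code D = \<Inter> ((\<lambda>x. {y. scalar_product x y = 0}) ` D)"
    by (auto simp: dual_code_def)
  then show ?thesis
    using vec.subspace_Inter[of "(\<lambda>x. {y. scalar_product x y = 0}) ` D"]
      subspace_scalar_product_eq_0 by auto
qed

lemma dual_code_span:
  fixes B :: "('a::field ^ 'n::finite) set"
  shows "dual_code (vec.span B) = dual_code B"
proof (intro equalityI subsetI)
  fix y assume "y \<in> dual_code B"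
  then have "B \<subseteq> {x. scalar_product y x = 0}"
    by (auto simp: dual_code_def scalar_product_commute)
  then have "vec.span B \<subseteq> {x. scalar_product y x = 0}"
    using subspace_scalar_product_eq_0 by (rule vec.span_minimal)
  then show "y \<in> dual_code (vec.span B)"
    by (auto simp: dual_code_def scalar_product_commute)
qed (auto simp: dual_code_def vec.span_base)

text \<open>If \<open>E\<close> extends a basis of \<open>V \<inter> D\<^sup>\<bottom>\<close> to a basis of \<open>V\<close>, then \<open>x \<in> D\<close> is determined modulo
  \<open>V\<^sup>\<bottom>\<close> by its products with the elements of \<open>E\<close>.\<close>

lemma card_dual_pairing_le:
  fixes D V :: "('a::{field,finite} ^ 'n::finite) set"
  assumes D: "vec.subspace D" and V: "vec.subspace V"
  shows "card D * card (V \<inter> dual_code D) \<le> card V * card (D \<inter> dual_code V)"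
proof -
  let ?W = "V \<inter> dual_code D"
  have W: "vec.subspace ?W" using V subspace_dual_code by (rule vec.subspace_inter)
  obtain B0 where B0: "B0 \<subseteq> ?W" "vec.independent B0" "?W \<subseteq> vec.span B0"
    using vec.maximal_independent_subset[of ?W] by metis
  obtain B1 where B1: "B0 \<subseteq> B1" "B1 \<subseteq> V" "vec.independent B1" "V \<subseteq> vec.span B1"
    using vec.maximal_independent_subset_extend[of B0 V] B0 by blast
  have "vec.span B0 = ?W" and span: "vec.span B1 = V"
    using B0 B1 V W vec.span_subspace by blast+
  then have card_W: "card ?W = CARD('a) ^ card B0" and card_V: "card V = CARD('a) ^ card B1"
    using card_span_independent B0(2) B1(3) by metis+
  \<comment> \<open>\<open>CARD('a) ^ card E\<close> is the index of \<open>?W\<close> in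
    \<open>V\<close>.\<close>
  define E where "E = B1 - B0"
  have "card B1 = card E + card B0"
    using card_mono[OF _ B1(1)] by (simp add: E_def card_Diff_subset[OF _ B1(1)])
  then have card_V': "card V = CARD('a) ^ card E * card ?W"
    by (simp add: card_V card_W power_add)
  define f where "f x = restrict (\<lambda>e. scalar_product e x) E" for x
  have "f x = f y \<longleftrightarrow> x - y \<in> dual_code E" for x y
    by (auto simp: f_def fun_eq_iff restrict_def dual_code_def scalar_product_diff_right)
  then have "card D = card (f ` D) * card (D \<inter> dual_code E)"
    by (rule card_eq_card_image_mult[OF D])
  \<comment> \<open>Members of \<open>D\<close> are orthogonal to \<open>B0\<close> automatically,
    so within \<open>D\<close> orthogonality to \<open>E\<close> already means orthogonality to all
    of \<open>V\<close>.\<close>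
  moreover have "D \<subseteq> dual_code B0"
  proof
    fix x assume "x \<in> D"
    then have "scalar_product x e = 0" if "e \<in> B0" for e
      using that B0(1) by (auto simp: dual_code_def)
    then show "x \<in> dual_code B0"
      by (simp add: dual_code_def scalar_product_commute[of _ x])
  qed
  then have "D \<inter> dual_code E = D \<inter> dual_code V"
    unfolding span[symmetric] dual_code_span by (auto simp: dual_code_def E_def)
  moreover have "card (f ` D) \<le> card (E \<rightarrow>\<^sub>E (UNIV :: 'a set))"
    by (intro card_mono finite_PiE) (auto simp: f_def)
  then have "card (f ` D) \<le> CARD('a) ^ card E" by (simp add: card_PiE)
  ultimately have "card D \<le> CARD('a) ^ card E * card (D \<inter> dual_code V)" by simp
  then have "card D * card ?W \<le> CARD('a) ^ card E * card (D \<inter> dual_code V) * card ?W"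
    by (rule mult_right_mono) simp
  then show ?thesis by (simp add: card_V' mult_ac)
qed

text \<open>Exchanging \<open>D\<close> and \<open>V\<close> turns the preceding inequality into its
  reverse.\<close>

lemma card_dual_pairing:
  fixes D V :: "('a::{field,finite} ^ 'n::finite) set"
  assumes "vec.subspace D" "vec.subspace V"
  shows "card D * card (V \<inter> dual_code D) = card V * card (D \<inter> dual_code V)"
  using card_dual_pairing_le[OF assms] card_dual_pairing_le[OF assms(2,1)]
  by (simp add: le_antisym)

lemma rows_mult_eq_iff:
  fixes B :: "('a::field ^ 'n::finite) list"
  shows "rows_mult B x = rows_mult B y \<longleftrightarrow> x - y \<in> dual_code (vec.span (set B))"
  unfolding dual_code_span
  by (auto simp: rows_mult_def dual_code_def scalar_product_diff_right)

text \<open>Apply the dimension formula to \<open>D1 \<inter> W\<close> and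
  \<open>D2 \<inter> V\<close>: they meet in \<open>D2 \<inter> W\<close>, and their sum lies in
  \<open>D1 \<inter> V\<close>.\<close>

lemma RDIP_integrand_mono:
  fixes D1 D2 V W :: "('a::field ^ 'n::finite) set"
  assumes "vec.subspace D1" "vec.subspace D2" "D2 \<subseteq> D1" "vec.subspace V" "vec.subspace W" "W \<subseteq> V"
  shows "int (vec.dim (D1 \<inter> W)) - int (vec.dim (D2 \<inter> W))
    \<le> int (vec.dim (D1 \<inter> V)) - int (vec.dim (D2 \<inter> V))"
proof -
  have s: "vec.subspace (D1 \<inter> W)" "vec.subspace (D2 \<inter> V)" "vec.subspace (D1 \<inter> V)"
    using assms by (simp_all add: vec.subspace_inter)
  have "(D1 \<inter> W) \<inter> (D2 \<inter> V) = D2 \<inter> W" using assms(3,6) by blast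
  then have "vec.dim {x + y |x y. x \<in> D1 \<inter> W \<and> y \<in> D2 \<inter> V} + vec.dim (D2 \<inter> W)
      = vec.dim (D1 \<inter> W) + vec.dim (D2 \<inter> V)"
    using vec.dim_sums_Int[OF s(1,2)] by simp
  moreover have "{x + y |x y. x \<in> D1 \<inter> W \<and> y \<in> D2 \<inter> V} \<subseteq> D1 \<inter> V"
    using assms(3,6) vec.subspace_add[OF s(3)] by blast
  then have "vec.dim {x + y |x y. x \<in> D1 \<inter> W \<and> y \<in> D2 \<inter> V} \<le> vec.dim (D1 \<inter> V)"
    by (rule vec.dim_subset)
  ultimately show ?thesis by linarith
qed

subsection \<open>Entropy of finite distributions\<close>

lemma measurable_joint_event:
  assumes S: "S \<in> measurable M (count_space UNIV)" and X: "X \<in> measurable M (count_space UNIV)"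
  shows "{\<omega> \<in> space M. S \<omega> = s \<and> X \<omega> = x} \<in> sets M"
proof -
  have "{\<omega> \<in> space M. S \<omega> = s \<and> X \<omega> = x} = (S -` {s} \<inter> space M) \<inter> (X -` {x} \<inter> space M)"
    by auto
  then show ?thesis using measurable_sets[OF S] measurable_sets[OF X] by auto
qed

text \<open>A measure-free setting for the entropy estimates. The type of the values of
  \<open>f\<close> may be infinite, so sums over observations run over
  \<open>range f\<close>.\<close>

locale finite_joint_distribution =
  fixes p :: "'s::finite \<Rightarrow> 'x::finite \<Rightarrow> real" and f :: "'x \<Rightarrow> 'y"
  assumes nonneg: "0 \<le> p s x" and sum_eq_1: "(\<Sum>s\<in>UNIV. \<Sum>x\<in>UNIV. p s x) = 1"
begin

definition joint :: "'s \<Rightarrow> 'y \<Rightarrow> real" where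
  "joint s y = (\<Sum>x | f x = y. p s x)"

definition marginal :: "'y \<Rightarrow> real" where
  "marginal y = (\<Sum>s\<in>UNIV. joint s y)"

lemma joint_nonneg: "0 \<le> joint s y"
  by (simp add: joint_def nonneg sum_nonneg)

lemma marginal_nonneg: "0 \<le> marginal y"
  by (simp add: marginal_def joint_nonneg sum_nonneg)

lemma le_joint: "p s x \<le> joint s (f x)"
  unfolding joint_def by (rule member_le_sum) (auto simp: nonneg)

lemma joint_le_marginal: "joint s y \<le> marginal y"
  unfolding marginal_def by (rule member_le_sum) (auto simp: joint_nonneg)

lemma sum_group: "(\<Sum>x\<in>UNIV. p s x * g (f x)) = (\<Sum>y\<in>range f. joint s y * g y)"
  unfolding joint_def sum_distrib_right
  by (subst sum.image_gen[of UNIV _ f]) (auto intro!: sum.cong)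

lemma sum_marginal: "(\<Sum>y\<in>range f. marginal y) = 1"
proof -
  have "(\<Sum>y\<in>range f. marginal y) = (\<Sum>s\<in>UNIV. \<Sum>y\<in>range f. joint s y)"
    unfolding marginal_def by (rule sum.swap)
  also have "\<dots> = 1"
    using sum_group[of _ "\<lambda>_. 1"] sum_eq_1 by simp
  finally show ?thesis .
qed

text \<open>The entropy of the first coordinate given \<open>f\<close> of the second. Summing over
  \<open>x\<close> rather than \<open>f x\<close> permits a termwise comparison with sums over
  \<open>p s x\<close>; where \<open>p s x = 0\<close> the summand vanishes.\<close>

definition equivocation :: "real \<Rightarrow> real" where
  "equivocation b = - (\<Sum>s\<in>UNIV. \<Sum>x\<in>UNIV. p s x * log b (joint s (f x) / marginal (f x)))"

text \<open>Gibbs' inequality against the uniform weight \<open>1 / N\<close>: \<open>z\<close>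
  below is the ratio of this weight to the conditional probability of \<open>s\<close>. The mean of
  \<open>z\<close> is at most 1, since each observation admits at most \<open>N\<close> values of
  \<open>s\<close>.\<close>

lemma equivocation_le_log_card:
  fixes N :: real
  assumes b: "b > 1" and N: "N > 0" and card: "\<And>y. card {s. joint s y > 0} \<le> N"
  shows "equivocation b \<le> log b N"
proof -
  let ?T = "\<lambda>s x. p s x * (marginal (f x) / (N * joint s (f x)))"
  have "- (p s x * ln (joint s (f x) / marginal (f x))) \<le> ?T s x + p s x * (ln N - 1)" for s x
  proof (cases "p s x = 0")
    case False
    then have pos: "p s x > 0" "joint s (f x) > 0" "marginal (f x) > 0"
      using nonneg[of s x] le_joint[of s x] joint_le_marginal[of s "f x"] by linarith+
    define z where "z = marginal (f x) / (N * joint s (f x))"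
    have "z > 0" using pos N by (simp add: z_def)
    then have "ln z \<le> z - 1" by (rule ln_le_minus_one)
    moreover have "ln z = - ln (joint s (f x) / marginal (f x)) - ln N"
      using pos N by (simp add: z_def ln_div ln_mult)
    ultimately have "- ln (joint s (f x) / marginal (f x)) \<le> z + (ln N - 1)" by simp
    then have "p s x * - ln (joint s (f x) / marginal (f x)) \<le> p s x * (z + (ln N - 1))"
      using pos(1) by (intro mult_left_mono) simp_all
    then show ?thesis by (simp add: z_def distrib_left)
  qed simp
  then have "(\<Sum>s\<in>UNIV. \<Sum>x\<in>UNIV. - (p s x * ln (joint s (f x) / marginal (f x))))
      \<le> (\<Sum>s\<in>UNIV. \<Sum>x\<in>UNIV. ?T s x + p s x * (ln N - 1))"
    by (intro sum_mono)
  also have "\<dots> = (\<Sum>s\<in>UNIV. \<Sum>x\<in>UNIV. ?T s x) + (ln N - 1)"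
    by (simp add: sum.distrib sum_eq_1 flip: sum_distrib_right)
  also have "(\<Sum>s\<in>UNIV. \<Sum>x\<in>UNIV. ?T s x)
      = (\<Sum>s\<in>UNIV. \<Sum>y\<in>range f. joint s y * (marginal y / (N * joint s y)))"
    by (intro sum.cong refl sum_group)
  also have "\<dots> = (\<Sum>y\<in>range f. \<Sum>s\<in>UNIV. joint s y * (marginal y / (N * joint s y)))"
    by (rule sum.swap)
  \<comment> \<open>Where \<open>joint s y > 0\<close> this factor cancels; elsewhere the summand is
    0.\<close>
  also have "\<dots> = (\<Sum>y\<in>range f. \<Sum>s | joint s y > 0. marginal y / N)"
    by (intro sum.cong refl sum.mono_neutral_cong_right)
      (auto simp: joint_nonneg less_le)
  also have "\<dots> \<le> (\<Sum>y\<in>range f. marginal y)"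
  proof (rule sum_mono)
    fix y
    have "real (card {s. joint s y > 0}) * (marginal y / N) \<le> N * (marginal y / N)"
      using N card marginal_nonneg by (intro mult_right_mono) auto
    then show "(\<Sum>s | joint s y > 0. marginal y / N) \<le> marginal y" using N by simp
  qed
  also have "\<dots> = 1" by (rule sum_marginal)
  finally have "(\<Sum>s\<in>UNIV. \<Sum>x\<in>UNIV. - (p s x * ln (joint s (f x) / marginal (f x)))) \<le> ln N"
    by simp
  then have "(\<Sum>s\<in>UNIV. \<Sum>x\<in>UNIV. - (p s x * ln (joint s (f x) / marginal (f x)))) / ln b \<le> ln N / ln b"
    using b by (intro divide_right_mono) auto
  then show ?thesis
    by (simp add: equivocation_def log_def sum_divide_distrib sum_negf)
qed

text \<open>With Y = f(X), the left side is H(S,X) - log(n k), because the second sum is log c -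
  H(X|S). The bound is thus the chain rule H(S,X) = H(Y) + H(S|Y) + H(X|S,Y) with H(Y) at most log n
  and H(X|S,Y) at most log k. One use of \<open>ln z \<le> z - 1\<close> settles both estimates
  together.\<close>

lemma equivocation_ge:
  fixes pS :: "'s \<Rightarrow> real" and c k n :: real
  defines "pS \<equiv> \<lambda>s. \<Sum>x\<in>UNIV. p s x"
  assumes b: "b > 1" and pos: "c > 0" "k > 0" "n > 0"
    and fiber: "\<And>s y. card {x. f x = y \<and> p s x > 0} \<le> k"
    and image: "card {y \<in> range f. marginal y > 0} \<le> n"
  shows "- (\<Sum>s\<in>UNIV. pS s * log b (pS s))
      - (\<Sum>s\<in>UNIV. \<Sum>x\<in>UNIV. p s x * log b (p s x * c / pS s)) - log b (n * k / c)
    \<le> equivocation b"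
proof -
  let ?J = "\<lambda>s x. joint s (f x)" and ?Y = "\<lambda>x. marginal (f x)"
  let ?L = "\<lambda>s x. p s x * (ln (?J s x / ?Y x) - ln (pS s) - ln (p s x * c / pS s) - ln (n * k / c))"
  \<comment> \<open>The restriction to the support of \<open>p\<close> is what lets
    \<open>fiber\<close> bound the number of contributing \<open>x\<close>.\<close>
  let ?R = "\<lambda>s x. (if p s x > 0 then ?J s x / (?Y x * k * n) else 0)"
  have "?L s x \<le> ?R s x - p s x" for s x
  proof (cases "p s x = 0")
    case False
    have "p s x \<le> pS s" unfolding pS_def by (rule member_le_sum) (auto simp: nonneg)
    with False have p: "p s x > 0" "?J s x > 0" "?Y x > 0" "pS s > 0"
      using nonneg[of s x] le_joint[of s x] joint_le_marginal[of s "f x"] by linarith+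
    define z where "z = ?J s x / (?Y x * p s x * k * n)"
    have "z > 0" using p pos by (simp add: z_def)
    then have "ln z \<le> z - 1" by (rule ln_le_minus_one)
    moreover have "ln z = ln (?J s x / ?Y x) - ln (pS s) - ln (p s x * c / pS s) - ln (n * k / c)"
      using p pos by (simp add: z_def ln_div ln_mult)
    ultimately have "?L s x \<le> p s x * (z - 1)"
      using p(1) by (intro mult_left_mono) simp_all
    also have "\<dots> = ?R s x - p s x" using p pos by (simp add: z_def field_simps)
    finally show ?thesis .
  qed simp
  then have "(\<Sum>s\<in>UNIV. \<Sum>x\<in>UNIV. ?L s x) \<le> (\<Sum>s\<in>UNIV. \<Sum>x\<in>UNIV. ?R s x - p s x)"
    by (intro sum_mono)
  also have "\<dots> = (\<Sum>s\<in>UNIV. \<Sum>x\<in>UNIV. ?R s x) - 1"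
    by (simp add: sum_subtractf sum_eq_1)
  also have "(\<Sum>s\<in>UNIV. \<Sum>x\<in>UNIV. ?R s x)
      \<le> (\<Sum>s\<in>UNIV. \<Sum>y\<in>range f. joint s y / (marginal y * n))"
  proof (rule sum_mono)
    fix s
    have "(\<Sum>x\<in>UNIV. ?R s x) = (\<Sum>y\<in>range f. \<Sum>x | x \<in> UNIV \<and> f x = y. ?R s x)"
      by (rule sum.image_gen) simp
    also have "\<dots> = (\<Sum>y\<in>range f. \<Sum>x | f x = y \<and> p s x > 0. joint s y / (marginal y * k * n))"
      by (intro sum.cong refl sum.mono_neutral_cong_right) auto
    also have "\<dots> \<le> (\<Sum>y\<in>range f. joint s y / (marginal y * n))"
    proof (rule sum_mono)
      fix y
      have "real (card {x. f x = y \<and> p s x > 0}) * (joint s y / (marginal y * k * n))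
          \<le> k * (joint s y / (marginal y * k * n))"
        using pos fiber joint_nonneg marginal_nonneg by (intro mult_right_mono) auto
      then show "(\<Sum>x | f x = y \<and> p s x > 0. joint s y / (marginal y * k * n))
          \<le> joint s y / (marginal y * n)"
        using pos by (simp add: mult.assoc mult.left_commute[of _ k])
    qed
    finally show "(\<Sum>x\<in>UNIV. ?R s x) \<le> (\<Sum>y\<in>range f. joint s y / (marginal y * n))" .
  qed
  also have "(\<Sum>s\<in>UNIV. \<Sum>y\<in>range f. joint s y / (marginal y * n))
      = (\<Sum>y\<in>range f. marginal y / (marginal y * n))"
    by (subst sum.swap) (simp add: marginal_def flip: sum_divide_distrib)
  \<comment> \<open>Observations of marginal 0 contribute nothing, as division by 0 yields 0; at
    most \<open>n\<close> terms \<open>1 / n\<close> remain.\<close>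
  also have "\<dots> = (\<Sum>y | y \<in> range f \<and> marginal y > 0. 1 / n)"
    by (intro sum.mono_neutral_cong_right) (auto simp: marginal_nonneg less_le)
  also have "\<dots> \<le> 1" using image pos by simp
  finally have "(\<Sum>s\<in>UNIV. \<Sum>x\<in>UNIV. ?L s x) \<le> 0" by simp
  also have "(\<Sum>s\<in>UNIV. \<Sum>x\<in>UNIV. ?L s x)
      = (\<Sum>s\<in>UNIV. \<Sum>x\<in>UNIV. p s x * ln (?J s x / ?Y x)) - (\<Sum>s\<in>UNIV. pS s * ln (pS s))
        - (\<Sum>s\<in>UNIV. \<Sum>x\<in>UNIV. p s x * ln (p s x * c / pS s)) - ln (n * k / c)"
    by (simp add: right_diff_distrib sum_subtractf sum_eq_1 pS_def flip: sum_distrib_right)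
  finally have "((\<Sum>s\<in>UNIV. \<Sum>x\<in>UNIV. p s x * ln (?J s x / ?Y x)) - (\<Sum>s\<in>UNIV. pS s * ln (pS s))
        - (\<Sum>s\<in>UNIV. \<Sum>x\<in>UNIV. p s x * ln (p s x * c / pS s)) - ln (n * k / c)) / ln b \<le> 0"
    using b by (simp add: divide_nonpos_pos)
  then show ?thesis
    by (simp add: equivocation_def log_def sum_divide_distrib sum_negf diff_divide_distrib)
qed

end

section \<open>Entropy and divergence of random variables as finite sums\<close>

lemma KL_divergence_uniform_on:
  fixes A :: "'x::finite set" and N :: "'x measure"
  assumes b: "b > 1" and N: "prob_space N" "sets N = UNIV" and A: "measure N (- A) = 0"
  shows "KL_divergence b (uniform_on A) N
    = (\<Sum>x\<in>UNIV. measure N {x} * log b (measure N {x} * card A))"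
proof -
  interpret N: prob_space N by fact
  have spN: "space N = UNIV" using sets_eq_imp_space_eq[of N "count_space UNIV"] N(2) by simp
  have A_ne: "A \<noteq> {}"
    using A N.prob_space spN by auto
  then have cA: "card A > 0" by (simp add: card_gt_0_iff)
  interpret U: prob_space "uniform_on A"
    using A_ne by (intro prob_space_uniform_measure) simp_all
  let ?f = "\<lambda>x. measure N {x} * card A"
  have out: "measure N {x} = 0" if "x \<notin> A" for x
  proof -
    have "measure N {x} \<le> measure N (- A)"
      using that N(2) by (intro N.finite_measure_mono) auto
    then show ?thesis using A by (simp add: measure_le_0_iff)
  qed
  have dens: "uniform_on A = point_measure UNIV (\<lambda>x. ennreal (indicator A x / card A))"
    unfolding uniform_measure_def point_measure_def
    using divide_ennreal[of 1 "card A"] cA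
    by (intro density_cong) (auto simp: indicator_def ennreal_of_nat_eq_real_of_nat)
  have meas: "?f \<in> borel_measurable (uniform_on A)" by (simp add: uniform_measure_def)
  \<comment> \<open>On \<open>A\<close> the factor \<open>card A\<close> cancels the uniform weight;
    off \<open>A\<close> both measures vanish because \<open>N\<close> is concentrated on
    \<open>A\<close>. So \<open>?f\<close> is the density that enters the divergence.\<close>
  have "density (uniform_on A) ?f = N"
  proof (rule measure_eqI)
    fix E assume "E \<in> sets (density (uniform_on A) ?f)"
    have "emeasure (density (uniform_on A) ?f) E = (\<integral>\<^sup>+ x. ennreal (?f x) * indicator E x \<partial>uniform_on A)"
      by (rule emeasure_density) (simp_all add: uniform_measure_def)
    also have "\<dots> = (\<Sum>x\<in>UNIV. ennreal (indicator A x / card A) * (ennreal (?f x) * indicator E x))"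
      unfolding dens by (subst nn_integral_point_measure_finite) (auto simp: mult.commute)
    also have "\<dots> = (\<Sum>x\<in>UNIV. ennreal (measure N {x} * indicator E x))"
      using cA out by (intro sum.cong refl) (auto simp: indicator_def simp flip: ennreal_mult)
    also have "\<dots> = ennreal (\<Sum>x\<in>UNIV. measure N {x} * indicator E x)"
      by (rule sum_ennreal) simp
    also have "(\<Sum>x\<in>UNIV. measure N {x} * indicator E x) = (\<Sum>x\<in>E. measure N {x})"
      by (simp add: indicator_def if_distrib sum.If_cases cong: if_cong)
    also have "\<dots> = measure N E"
      using N(2) by (intro N.finite_measure_eq_sum_singleton[symmetric]) auto
    finally show "emeasure (density (uniform_on A) ?f) E = emeasure N E"
      by (simp add: N.emeasure_eq_measure)
  qed (simp add: N(2))
  then have "KL_divergence b (uniform_on A) N = (\<integral>x. ?f x * log b (?f x) \<partial>uniform_on A)"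
    using U.KL_density[of b ?f] b meas by simp
  also have "\<dots> = (\<Sum>x\<in>UNIV. indicator A x / card A * (?f x * log b (?f x)))"
    unfolding dens by (subst lebesgue_integral_point_measure_finite) auto
  also have "\<dots> = (\<Sum>x\<in>UNIV. measure N {x} * log b (?f x))"
    using cA out by (intro sum.cong refl) (auto simp: indicator_def)
  finally show ?thesis .
qed

context information_space
begin

lemma entropy_eq_sum_UNIV:
  fixes S :: "'a \<Rightarrow> 's::finite"
  assumes S: "S \<in> measurable M (count_space UNIV)"
  shows "\<H>(S) = - (\<Sum>s\<in>UNIV. prob (S -` {s} \<inter> space M) * log b (prob (S -` {s} \<inter> space M)))"
proof -
  have "simple_function M S"
    using measurable_sets[OF S] by (auto simp: simple_function_def)
  then have "simple_distributed M S (\<lambda>s. prob (S -` {s} \<inter> space M))"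
    by (rule simple_distributedI) auto
  then have "\<H>(S) = - (\<Sum>s\<in>S ` space M. prob (S -` {s} \<inter> space M) * log b (prob (S -` {s} \<inter> space M)))"
    by (rule entropy_simple_distributed)
  also have "(\<Sum>s\<in>S ` space M. prob (S -` {s} \<inter> space M) * log b (prob (S -` {s} \<inter> space M)))
      = (\<Sum>s\<in>UNIV. prob (S -` {s} \<inter> space M) * log b (prob (S -` {s} \<inter> space M)))"
  \<comment> \<open>Values that \<open>S\<close> never takes have an empty preimage and contribute
    0.\<close>
  proof (rule sum.mono_neutral_left)
    have "S -` {s} \<inter> space M = {}" if "s \<notin> S ` space M" for s using that by auto
    then show "\<forall>s\<in>UNIV - S ` space M. prob (S -` {s} \<inter> space M) * log b (prob (S -` {s} \<inter> space M)) = 0"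
      by simp
  qed auto
  finally show ?thesis .
qed

lemma finite_joint_distribution_prob:
  fixes S :: "'a \<Rightarrow> 's::finite" and X :: "'a \<Rightarrow> 'x::finite"
  assumes S: "S \<in> measurable M (count_space UNIV)" and X: "X \<in> measurable M (count_space UNIV)"
  shows "finite_joint_distribution (\<lambda>s x. prob {\<omega> \<in> space M. S \<omega> = s \<and> X \<omega> = x})"
    and "(\<Sum>x\<in>UNIV. prob {\<omega> \<in> space M. S \<omega> = s \<and> X \<omega> = x}) = prob (S -` {s} \<inter> space M)"
proof -
  note [measurable] = measurable_joint_event[OF S X]
  have S_sum: "(\<Sum>x\<in>UNIV. prob {\<omega> \<in> space M. S \<omega> = s \<and> X \<omega> = x}) = prob (S -` {s} \<inter> space M)" for s
    by (subst finite_measure_finite_Union[symmetric])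
      (auto simp: disjoint_family_on_def intro!: arg_cong[where f = prob])
  then show "(\<Sum>x\<in>UNIV. prob {\<omega> \<in> space M. S \<omega> = s \<and> X \<omega> = x}) = prob (S -` {s} \<inter> space M)" .
  have "(\<Sum>s\<in>UNIV. prob (S -` {s} \<inter> space M)) = prob (\<Union>s\<in>UNIV. S -` {s} \<inter> space M)"
    using measurable_sets[OF S]
    by (intro finite_measure_finite_Union[symmetric]) (auto simp: disjoint_family_on_def)
  also have "(\<Union>s\<in>UNIV. S -` {s} \<inter> space M) = space M" by auto
  finally show "finite_joint_distribution (\<lambda>s x. prob {\<omega> \<in> space M. S \<omega> = s \<and> X \<omega> = x})"
    by unfold_locales (simp_all add: S_sum prob_space)
qed

text \<open>The bridge from \<open>cond_Ent\<close> to the locale: the sum over attained pairs is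
  extended by pairs of joint probability 0 and then ungrouped from observations to points
  \<open>x\<close>.\<close>

lemma conditional_entropy_eq_equivocation:
  fixes S :: "'a \<Rightarrow> 's::finite" and X :: "'a \<Rightarrow> 'x::finite" and f :: "'x \<Rightarrow> 'y"
  assumes S: "S \<in> measurable M (count_space UNIV)" and X: "X \<in> measurable M (count_space UNIV)"
  shows "\<H>(S | \<lambda>\<omega>. f (X \<omega>))
    = finite_joint_distribution.equivocation (\<lambda>s x. prob {\<omega> \<in> space M. S \<omega> = s \<and> X \<omega> = x}) f b"
proof -
  define p where "p s x = prob {\<omega> \<in> space M. S \<omega> = s \<and> X \<omega> = x}" for s x
  interpret J: finite_joint_distribution p f
    unfolding p_def by (rule finite_joint_distribution_prob[OF S X])
  let ?Y = "\<lambda>\<omega>. f (X \<omega>)"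
  have sS: "simple_function M S" and sX: "simple_function M X"
    using measurable_sets[OF S] measurable_sets[OF X] by (auto simp: simple_function_def)
  have sY: "simple_function M ?Y" using simple_function_compose[OF sX, of f] by (simp add: comp_def)
  have sSY: "simple_function M (\<lambda>\<omega>. (S \<omega>, ?Y \<omega>))" using sS sY by (rule simple_function_Pair)
  let ?PY = "\<lambda>y. prob (?Y -` {y} \<inter> space M)"
  let ?PSY = "\<lambda>sy. prob ((\<lambda>\<omega>. (S \<omega>, ?Y \<omega>)) -` {sy} \<inter> space M)"
  note meas = measurable_joint_event[OF S X]
  have joint: "?PSY (s, y) = J.joint s y" for s y
  proof -
    have "(\<lambda>\<omega>. (S \<omega>, ?Y \<omega>)) -` {(s, y)} \<inter> space M
        = (\<Union>x\<in>{x. f x = y}. {\<omega> \<in> space M. S \<omega> = s \<and> X \<omega> = x})" by auto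
    then show ?thesis unfolding J.joint_def p_def
      using meas by (simp only:) (intro finite_measure_finite_Union, auto simp: disjoint_family_on_def)
  qed
  have marginal: "?PY y = J.marginal y" for y
  proof -
    have "?Y -` {y} \<inter> space M = (\<Union>s\<in>UNIV. (\<lambda>\<omega>. (S \<omega>, ?Y \<omega>)) -` {(s, y)} \<inter> space M)" by auto
    then have "?PY y = (\<Sum>s\<in>UNIV. ?PSY (s, y))"
      using simple_functionD(2)[OF sSY]
      by (simp only:) (intro finite_measure_finite_Union, auto simp: disjoint_family_on_def)
    then show ?thesis by (simp add: joint J.marginal_def)
  qed
  let ?g = "\<lambda>(s, y). J.joint s y * log b (J.joint s y / J.marginal y)"
  have "\<H>(S | ?Y) = - (\<Sum>(s, y)\<in>(\<lambda>\<omega>. (S \<omega>, ?Y \<omega>)) ` space M. ?PSY (s, y) * log b (?PSY (s, y) / ?PY y))"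
    by (intro conditional_entropy_eq simple_distributedI[OF sY] simple_distributedI[OF sSY])
      (auto intro: measure_nonneg)
  also have "\<dots> = - (\<Sum>z\<in>(\<lambda>\<omega>. (S \<omega>, ?Y \<omega>)) ` space M. ?g z)"
    by (simp add: joint marginal)
  also have "(\<Sum>z\<in>(\<lambda>\<omega>. (S \<omega>, ?Y \<omega>)) ` space M. ?g z) = (\<Sum>z\<in>UNIV \<times> range f. ?g z)"
  proof (rule sum.mono_neutral_left)
    have "J.joint s y = 0" if "(s, y) \<notin> (\<lambda>\<omega>. (S \<omega>, ?Y \<omega>)) ` space M" for s y
    proof -
      have "(\<lambda>\<omega>. (S \<omega>, ?Y \<omega>)) -` {(s, y)} \<inter> space M = {}" using that by auto
      then show ?thesis by (metis joint measure_empty)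
    qed
    then show "\<forall>z\<in>UNIV \<times> range f - (\<lambda>\<omega>. (S \<omega>, ?Y \<omega>)) ` space M. ?g z = 0" by auto
  qed auto
  also have "\<dots> = (\<Sum>s\<in>UNIV. \<Sum>y\<in>range f. J.joint s y * log b (J.joint s y / J.marginal y))"
    by (simp add: sum.cartesian_product)
  also have "\<dots> = (\<Sum>s\<in>UNIV. \<Sum>x\<in>UNIV. p s x * log b (J.joint s (f x) / J.marginal (f x)))"
    by (intro sum.cong refl J.sum_group[symmetric])
  finally show ?thesis unfolding J.equivocation_def p_def[symmetric] by (simp add: p_def)
qed

text \<open>Given \<open>S = s\<close>, the law of \<open>X\<close> is concentrated on
  \<open>\<psi> s\<close>, so \<open>KL_divergence_uniform_on\<close> applies. Equal coset sizes
  \<open>c\<close> bring the sum into the shape found in \<open>equivocation_ge\<close>.\<close>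

lemma cond_divergence_uniform_eq_sum:
  fixes S :: "'a \<Rightarrow> 's::finite" and X :: "'a \<Rightarrow> 'x::finite"
  assumes S: "S \<in> measurable M (count_space UNIV)" and X: "X \<in> measurable M (count_space UNIV)"
    and AE: "AE \<omega> in M. X \<omega> \<in> \<psi> (S \<omega>)" and card: "\<And>s. card (\<psi> s) = c"
  shows "cond_divergence_uniform b M S X \<psi>
    = (\<Sum>s\<in>UNIV. \<Sum>x\<in>UNIV. prob {\<omega> \<in> space M. S \<omega> = s \<and> X \<omega> = x}
        * log b (prob {\<omega> \<in> space M. S \<omega> = s \<and> X \<omega> = x} * c / prob (S -` {s} \<inter> space M)))"
  unfolding cond_divergence_uniform_def
proof (rule sum.cong)
  fix s :: 's
  define E where "E = S -` {s} \<inter> space M"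
  define p where "p x = prob {\<omega> \<in> space M. S \<omega> = s \<and> X \<omega> = x}" for x
  have E: "E \<in> events" using measurable_sets[OF S] by (simp add: E_def)
  have eq: "E \<inter> (X -` {x} \<inter> space M) = {\<omega> \<in> space M. S \<omega> = s \<and> X \<omega> = x}" for x
    by (auto simp: E_def)
  show "measure M (S -` {s} \<inter> space M) * KL_divergence b (uniform_on (\<psi> s))
        (distr (uniform_measure M (S -` {s} \<inter> space M)) (count_space UNIV) X)
      = (\<Sum>x\<in>UNIV. prob {\<omega> \<in> space M. S \<omega> = s \<and> X \<omega> = x}
        * log b (prob {\<omega> \<in> space M. S \<omega> = s \<and> X \<omega> = x} * c / prob (S -` {s} \<inter> space M)))"
    unfolding E_def[symmetric] p_def[symmetric]
  proof (cases "prob E = 0")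
    \<comment> \<open>The conditional law is degenerate here, but its weight and all joint
      probabilities are 0.\<close>
    case True
    have "p x = 0" for x
    proof -
      have "p x \<le> prob E" unfolding p_def by (rule finite_measure_mono[OF _ E]) (auto simp: E_def)
      then show ?thesis using True by (simp add: p_def measure_le_0_iff)
    qed
    then show "prob E * KL_divergence b (uniform_on (\<psi> s)) (distr (uniform_measure M E) (count_space UNIV) X)
      = (\<Sum>x\<in>UNIV. p x * log b (p x * c / prob E))" using True by simp
  next
    case False
    let ?N = "distr (uniform_measure M E) (count_space UNIV) X"
    have eE: "emeasure M E \<noteq> 0" "emeasure M E \<noteq> \<infinity>" using False by (auto simp: emeasure_eq_measure)
    interpret UM: prob_space "uniform_measure M E" using eE by (rule prob_space_uniform_measure)
    have X': "X \<in> measurable (uniform_measure M E) (count_space UNIV)"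
      using X by (simp cong: measurable_cong_sets)
    have N: "measure ?N F = prob (E \<inter> (X -` F \<inter> space M)) / prob E" for F
      using X' E eE measurable_sets[OF X, of F] by (simp add: measure_distr measure_uniform_measure)
    have "measure ?N (- \<psi> s) = 0"
    proof -
      have "AE \<omega> in M. \<omega> \<notin> E \<inter> (X -` (- \<psi> s) \<inter> space M)"
        using AE by eventually_elim (auto simp: E_def)
      moreover have "E \<inter> (X -` (- \<psi> s) \<inter> space M) \<in> events"
        using E measurable_sets[OF X] by auto
      ultimately show ?thesis using prob_eq_0 by (simp add: N)
    qed
    then have "KL_divergence b (uniform_on (\<psi> s)) ?N
        = (\<Sum>x\<in>UNIV. measure ?N {x} * log b (measure ?N {x} * card (\<psi> s)))"
      using b_gt_1 UM.prob_space_distr[OF X'] by (intro KL_divergence_uniform_on) auto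
    also have "\<dots> = (\<Sum>x\<in>UNIV. p x / prob E * log b (p x * c / prob E))"
      by (simp add: N eq card p_def)
    finally show "prob E * KL_divergence b (uniform_on (\<psi> s)) ?N
      = (\<Sum>x\<in>UNIV. p x * log b (p x * c / prob E))"
      using False by (simp add: sum_distrib_left)
  qed
qed simp

end

subsection \<open>The equivocation of a fixed matrix\<close>

text \<open>A coset equals \<open>x +o W\<close> for each of its points \<open>x\<close>, so cosets
  that meet coincide; injectivity of \<open>\<psi>\<close> then identifies the arguments.\<close>

lemma linear_bij_quotientD:
  fixes C W :: "('a::field ^ 'n::finite) set" and \<psi> :: "'a ^ 'l \<Rightarrow> ('a ^ 'n) set"
  assumes \<psi>: "linear_bij_quotient C W \<psi>" and C: "vec.subspace C" and W: "vec.subspace W" "W \<subseteq> C"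
  shows "\<exists>a. \<psi> s = a +o W" "\<psi> s \<subseteq> C" "x \<in> \<psi> s \<Longrightarrow> x \<in> \<psi> t \<Longrightarrow> s = t"
proof -
  have inj: "inj \<psi>" and "range \<psi> = (\<lambda>x. x +o W) ` C"
    using \<psi> by (auto simp: linear_bij_quotient_def bij_betw_def quotient_space_def)
  then have ran: "\<exists>a\<in>C. \<psi> s = a +o W" for s by blast
  from ran show "\<exists>a. \<psi> s = a +o W" by blast
  show "\<psi> s \<subseteq> C"
    using ran[of s] subsetD[OF W(2)] vec.subspace_add[OF C] by (auto simp: elt_set_plus_def)
  assume x: "x \<in> \<psi> s" "x \<in> \<psi> t"
  have coset: "\<psi> u = x +o W" if xu: "x \<in> \<psi> u" for u
  proof -
    obtain a where a: "\<psi> u = a +o W" using ran by blast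
    then obtain w where w: "x = a + w" "w \<in> W" using xu by (auto simp: elt_set_plus_def)
    have "a + v = x + (v - w)" "x + v = a + (w + v)" for v by (simp_all add: w add.assoc)
    moreover have "v - w \<in> W" "w + v \<in> W" if "v \<in> W" for v
      using that w W(1) by (simp_all add: vec.subspace_diff vec.subspace_add)
    ultimately show ?thesis unfolding a elt_set_plus_def by blast
  qed
  have "\<psi> s = \<psi> t" using coset[OF x(1)] coset[OF x(2)] by simp
  with inj show "s = t" by (rule injD)
qed

lemma card_linear_bij_quotient:
  fixes C W :: "('a::field ^ 'n::finite) set" and \<psi> :: "'a ^ 'l \<Rightarrow> ('a ^ 'n) set"
  assumes "linear_bij_quotient C W \<psi>"
  shows "card (\<psi> s) = card W"
proof -
  have "range \<psi> = (\<lambda>x. x +o W) ` C"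
    using assms by (auto simp: linear_bij_quotient_def bij_betw_def quotient_space_def)
  then obtain a where "\<psi> s = a +o W" by blast
  moreover have "a +o W = (+) a ` W" by (auto simp: elt_set_plus_def)
  ultimately show ?thesis by (simp add: card_image)
qed

lemma equivocation_bounds:
  fixes C1 C2 :: "('a::{field,finite} ^ 'n::finite) set"
    and \<psi> :: "'a ^ 'l::finite \<Rightarrow> ('a ^ 'n) set"
    and M :: "'w measure" and S :: "'w \<Rightarrow> 'a ^ 'l" and X :: "'w \<Rightarrow> 'a ^ 'n"
    and B :: "('a ^ 'n) list"
  defines "b \<equiv> real CARD('a)" and "V \<equiv> vec.span (set B)"
  defines "\<kappa> \<equiv> real (vec.dim (dual_code C2 \<inter> V)) - real (vec.dim (dual_code C1 \<inter> V))"
  assumes C1: "vec.subspace C1" and C2: "vec.subspace C2" "C2 \<subseteq> C1"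
    and dim: "vec.dim C1 = vec.dim C2 + CARD('l)"
    and \<psi>: "linear_bij_quotient C1 C2 \<psi>" and M: "prob_space M"
    and S: "S \<in> measurable M (count_space UNIV)" and X: "X \<in> measurable M (count_space UNIV)"
    and SX: "AE \<omega> in M. X \<omega> \<in> \<psi> (S \<omega>)"
  shows "Ent b M S - cond_divergence_uniform b M S X \<psi> - \<kappa> \<le> cond_Ent b M S (\<lambda>\<omega>. rows_mult B (X \<omega>))"
    and "cond_Ent b M S (\<lambda>\<omega>. rows_mult B (X \<omega>)) \<le> real CARD('l) - \<kappa>"
proof -
  have "card {0, 1 :: 'a} \<le> CARD('a)" by (rule card_mono) auto
  then have b: "b > 1" by (simp add: b_def)
  interpret M: prob_space M by (rule M)
  interpret M: information_space M b by unfold_locales (rule b)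
  define f where "f = rows_mult B"
  define p where "p s x = measure M {\<omega> \<in> space M. S \<omega> = s \<and> X \<omega> = x}" for s x
  define k where "k C = card (C \<inter> dual_code V)" for C
  interpret J: finite_joint_distribution p f
    unfolding p_def by (rule M.finite_joint_distribution_prob[OF S X])
  note \<psi>D = linear_bij_quotientD[OF \<psi> C1 C2]
  have V: "vec.subspace V" by (simp add: V_def)
  have f_eq: "f x = f y \<longleftrightarrow> x - y \<in> dual_code V" for x y
    unfolding f_def V_def by (rule rows_mult_eq_iff)
  have k_pos: "k C > 0" if "vec.subspace C" for C
  proof -
    have "0 \<in> C \<inter> dual_code V"
      using that subspace_dual_code vec.subspace_0 by blast
    then show ?thesis by (auto simp: k_def card_gt_0_iff)
  qed
  have supp: "x \<in> \<psi> s" if "p s x > 0" for s x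
  proof (rule ccontr)
    assume "x \<notin> \<psi> s"
    with SX have "AE \<omega> in M. \<not> (S \<omega> = s \<and> X \<omega> = x)" by auto
    then have "p s x = 0" unfolding p_def by (rule M.prob_eq_0_AE)
    with that show False by simp
  qed
  have fiber: "card {z \<in> \<psi> s. f z = f x} = k C2" if "x \<in> \<psi> s" for s x
    using card_coset_fiber[OF C2(1) f_eq] \<psi>D(1)[of s] that by (auto simp: k_def)
  have fiber_le: "card {x. f x = y \<and> p s x > 0} \<le> k C2" for s y
  proof (cases "\<exists>x. f x = y \<and> p s x > 0")
    case True
    then obtain x where x: "f x = y" "p s x > 0" by blast
    have "card {x. f x = y \<and> p s x > 0} \<le> card {z \<in> \<psi> s. f z = f x}"
      using supp x by (intro card_mono) auto
    then show ?thesis using fiber[OF supp[OF x(2)]] x(1) by simp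
  next
    case False
    then have "card {x. f x = y \<and> p s x > 0} = 0" by (subst card_eq_0_iff) blast
    then show ?thesis by linarith
  qed
  have joint_pos: "\<exists>x. f x = y \<and> p s x > 0" if "J.joint s y > 0" for s y
  proof (rule ccontr)
    assume "\<not> ?thesis"
    then have "\<forall>x\<in>{x. f x = y}. p s x = 0" using J.nonneg[of s] by (auto simp: less_le)
    then have "J.joint s y = 0" unfolding J.joint_def by (rule sum.neutral)
    with that show False by simp
  qed
  have image: "{y \<in> range f. J.marginal y > 0} \<subseteq> f ` C1"
  proof
    fix y assume "y \<in> {y \<in> range f. J.marginal y > 0}"
    then have "(\<Sum>s\<in>UNIV. J.joint s y) \<noteq> 0" by (simp add: J.marginal_def)
    then obtain s where "J.joint s y \<noteq> 0" by (meson sum.neutral)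
    then have "J.joint s y > 0" using J.joint_nonneg[of s y] by simp
    then show "y \<in> f ` C1" using joint_pos supp \<psi>D(2) by blast
  qed
  \<comment> \<open>Each \<open>s\<close> compatible with \<open>y\<close> owns \<open>k C2\<close>
    points of the fibre over \<open>y\<close>. These sets are disjoint and lie in the fibre of
    \<open>C1\<close>, which has \<open>k C1\<close> points.\<close>
  have codewords: "card {s. J.joint s y > 0} * k C2 \<le> k C1" for y
  proof (cases "{s. J.joint s y > 0} = {}")
    case False
    then obtain x0 where x0: "x0 \<in> C1" "f x0 = y" using joint_pos supp \<psi>D(2) by blast
    have "card {z \<in> \<psi> s. f z = y} = k C2" if "J.joint s y > 0" for s
      using joint_pos[OF that] fiber supp by blast
    then have "card {s. J.joint s y > 0} * k C2 = (\<Sum>s | J.joint s y > 0. card {z \<in> \<psi> s. f z = y})"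
      by simp
    also have "\<dots> = card (\<Union>s\<in>{s. J.joint s y > 0}. {z \<in> \<psi> s. f z = y})"
      using \<psi>D(3) by (intro card_UN_disjoint[symmetric]) auto
    also have "\<dots> \<le> card {z \<in> 0 +o C1. f z = f x0}"
      using \<psi>D(2) x0 by (intro card_mono) auto
    also have "\<dots> = k C1"
      unfolding k_def using x0 by (intro card_coset_fiber[OF C1 f_eq]) simp
    finally show ?thesis .
  qed simp
  define d where "d C = vec.dim (dual_code C \<inter> V)" for C :: "('a ^ 'n) set"
  define v where "v = real (card V)"
  have "0 \<in> V" using V by (rule vec.subspace_0)
  then have v: "v > 0" by (auto simp: v_def card_gt_0_iff)
  have pairing: "real (card C) * b ^ d C = v * real (k C)" if "vec.subspace C" for C
    using arg_cong[OF card_dual_pairing[OF that V], of real]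
      card_subspace[of "dual_code C \<inter> V"] vec.subspace_inter[OF subspace_dual_code V]
    by (simp add: d_def v_def k_def b_def Int_commute)
  have card_C1: "real (card C1) = b ^ CARD('l) * real (card C2)"
    using C1 C2(1) by (simp add: card_subspace dim power_add b_def)
  have "C2 \<noteq> {}" using C2(1) vec.subspace_0 by blast
  then have c: "C2 \<noteq> {}" "real (card C2) > 0" by (simp_all add: card_gt_0_iff)
  have k: "real (k C1) > 0" "real (k C2) > 0" using k_pos C1 C2(1) by simp_all
  have eqk: "real (k C) = real (card C) * b ^ d C / v" if "vec.subspace C" for C
    using pairing[OF that] v by (simp add: field_simps)
  have log_power: "log b (b ^ i / b ^ j) = real i - real j" for i j
    using b by (simp add: log_divide log_nat_power)
  have \<kappa>: "\<kappa> = real (d C2) - real (d C1)" by (simp add: \<kappa>_def d_def)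
  have equiv: "cond_Ent b M S (\<lambda>\<omega>. rows_mult B (X \<omega>)) = J.equivocation b"
    using M.conditional_entropy_eq_equivocation[OF S X, of "rows_mult B"]
    by (simp add: p_def[abs_def] f_def)

  have "J.equivocation b \<le> log b (real (k C1) / real (k C2))"
  proof (rule J.equivocation_le_log_card[OF b])
    show "real (card {s. J.joint s y > 0}) \<le> real (k C1) / real (k C2)" for y
      using of_nat_mono[OF codewords[of y], where 'a = real] k by (simp add: field_simps)
  qed (use k in simp)
  also have "real (k C1) / real (k C2) = b ^ (CARD('l) + d C1) / b ^ d C2"
    using v c b by (simp add: eqk C1 C2(1) card_C1 power_add field_simps)
  finally show "cond_Ent b M S (\<lambda>\<omega>. rows_mult B (X \<omega>)) \<le> real CARD('l) - \<kappa>"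
    unfolding equiv log_power \<kappa> by simp

  note card_\<psi> = card_linear_bij_quotient[OF \<psi>]
  \<comment> \<open>The number of observations is counted on \<open>C1\<close>, since
    \<open>X\<close> lies in \<open>C1\<close> almost surely.\<close>
  have card_image: "real (card (f ` C1)) * real (k C1) = real (card C1)"
    unfolding k_def using card_eq_card_image_mult[OF C1 f_eq] by simp
  have "real (card (f ` C1)) > 0" using C1 vec.subspace_0 by (auto simp: card_gt_0_iff)
  moreover have "real (card {y \<in> range f. J.marginal y > 0}) \<le> real (card (f ` C1))"
    using card_mono[OF _ image] by simp
  ultimately have "- (\<Sum>s\<in>UNIV. (\<Sum>x\<in>UNIV. p s x) * log b (\<Sum>x\<in>UNIV. p s x))
      - (\<Sum>s\<in>UNIV. \<Sum>x\<in>UNIV. p s x * log b (p s x * real (card C2) / (\<Sum>x\<in>UNIV. p s x)))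
      - log b (real (card (f ` C1)) * real (k C2) / real (card C2)) \<le> J.equivocation b"
    using fiber_le by (intro J.equivocation_ge b c k) simp_all
  also have "real (card (f ` C1)) * real (k C2) / real (card C2) = b ^ d C2 / b ^ d C1"
  proof -
    have "real (card (f ` C1)) = v / b ^ d C1"
      using card_image v c b by (simp add: eqk C1 card_C1 field_simps)
    then show ?thesis using v c by (simp add: eqk C2(1))
  qed
  also have "- (\<Sum>s\<in>UNIV. (\<Sum>x\<in>UNIV. p s x) * log b (\<Sum>x\<in>UNIV. p s x)) = Ent b M S"
    using M.entropy_eq_sum_UNIV[OF S] by (simp add: p_def M.finite_joint_distribution_prob(2)[OF S X])
  also have "(\<Sum>s\<in>UNIV. \<Sum>x\<in>UNIV. p s x * log b (p s x * real (card C2) / (\<Sum>x\<in>UNIV. p s x)))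
      = cond_divergence_uniform b M S X \<psi>"
    using M.cond_divergence_uniform_eq_sum[OF S X SX card_\<psi>]
    by (simp add: p_def M.finite_joint_distribution_prob(2)[OF S X])
  finally show "Ent b M S - cond_divergence_uniform b M S X \<psi> - \<kappa>
      \<le> cond_Ent b M S (\<lambda>\<omega>. rows_mult B (X \<omega>))"
    unfolding equiv log_power \<kappa> .
qed

section \<open>Uniform message and uniform codeword\<close>

lemma measure_uniform_on_finite:
  fixes A :: "'x::finite set"
  assumes "A \<noteq> {}"
  shows "measure (uniform_on A) {x} = indicator A x / card A"
  using assms by (subst measure_uniform_measure) (auto simp: indicator_def)

lemma entropy_uniform_vector:
  fixes S :: "'w \<Rightarrow> 'a::{field,finite} ^ 'l::finite"
  assumes M: "information_space M (real CARD('a))"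
    and S: "S \<in> measurable M (count_space UNIV)"
    and unif: "distr M (count_space UNIV) S = uniform_on UNIV"
  shows "Ent (real CARD('a)) M S = real CARD('l)"
proof -
  interpret M: information_space M "real CARD('a)" by (rule M)
  have "M.prob (S -` {s} \<inter> space M) = 1 / real CARD('a) ^ CARD('l)" for s
    using measure_distr[OF S, of "{s}"] measure_uniform_on_finite[of UNIV s] by (simp add: unif)
  then show ?thesis
    using M.entropy_eq_sum_UNIV[OF S] M.b_gt_1 by (simp add: log_divide log_nat_power)
qed

text \<open>The cosets are disjoint, so \<open>X = x\<close> determines \<open>S\<close> almost
  surely and the joint mass is \<open>1 / card C1\<close> on each coset. As \<open>card C1\<close>
  is \<open>CARD('a) ^ CARD('l) * card C2\<close>, every logarithm with nonzero weight is taken at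
  1.\<close>

lemma cond_divergence_uniform_eq_0:
  fixes C1 C2 :: "('a::{field,finite} ^ 'n::finite) set"
    and \<psi> :: "'a ^ 'l::finite \<Rightarrow> ('a ^ 'n) set"
    and M :: "'w measure" and S :: "'w \<Rightarrow> 'a ^ 'l" and X :: "'w \<Rightarrow> 'a ^ 'n"
  assumes C1: "vec.subspace C1" and C2: "vec.subspace C2" "C2 \<subseteq> C1"
    and dim: "vec.dim C1 = vec.dim C2 + CARD('l)"
    and \<psi>: "linear_bij_quotient C1 C2 \<psi>" and M: "information_space M b"
    and S: "S \<in> measurable M (count_space UNIV)" and X: "X \<in> measurable M (count_space UNIV)"
    and SX: "AE \<omega> in M. X \<omega> \<in> \<psi> (S \<omega>)"
    and unif: "distr M (count_space UNIV) S = uniform_on UNIV" "distr M (count_space UNIV) X = uniform_on C1"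
  shows "cond_divergence_uniform b M S X \<psi> = 0"
proof -
  interpret M: information_space M b by (rule M)
  note \<psi>D = linear_bij_quotientD[OF \<psi> C1 C2]
  note card_\<psi> = card_linear_bij_quotient[OF \<psi>]
  have "C1 \<noteq> {}" using C1 vec.subspace_0 by blast
  have PS: "M.prob (S -` {s} \<inter> space M) = 1 / real CARD('a) ^ CARD('l)" for s
    using measure_distr[OF S, of "{s}"] measure_uniform_on_finite[of UNIV s] by (simp add: unif)
  have PX: "M.prob (X -` {x} \<inter> space M) = indicator C1 x / card C1" for x
    using measure_distr[OF X, of "{x}"] measure_uniform_on_finite[OF \<open>C1 \<noteq> {}\<close>] by (simp add: unif)
  note meas = measurable_joint_event[OF S X]
  have P: "M.prob {\<omega> \<in> space M. S \<omega> = s \<and> X \<omega> = x} = (if x \<in> \<psi> s then 1 / card C1 else 0)" for s x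
  proof (cases "x \<in> \<psi> s")
    case True
    have "AE \<omega> in M. \<omega> \<in> {\<omega> \<in> space M. S \<omega> = s \<and> X \<omega> = x} \<longleftrightarrow> \<omega> \<in> X -` {x} \<inter> space M"
      using SX by eventually_elim (use True \<psi>D(3) in auto)
    then have "M.prob {\<omega> \<in> space M. S \<omega> = s \<and> X \<omega> = x} = M.prob (X -` {x} \<inter> space M)"
      using meas measurable_sets[OF X] by (intro M.finite_measure_eq_AE) auto
    moreover have "x \<in> C1" using True \<psi>D(2) by blast
    ultimately show ?thesis using True by (simp add: PX)
  next
    case False
    with SX have "AE \<omega> in M. \<not> (S \<omega> = s \<and> X \<omega> = x)" by auto
    then show ?thesis using False by (simp add: M.prob_eq_0_AE)
  qed
  have "card C1 = CARD('a) ^ CARD('l) * card C2"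
    using C1 C2(1) by (simp add: card_subspace dim power_add)
  moreover have "C2 \<noteq> {}" using C2(1) vec.subspace_0 by blast
  ultimately have one: "1 / real (card C1) * real (card C2) / (1 / real CARD('a) ^ CARD('l)) = 1"
    by (simp add: field_simps)
  show ?thesis
    unfolding M.cond_divergence_uniform_eq_sum[OF S X SX card_\<psi>] P PS
    using one by (intro sum.neutral ballI) simp
qed

section \<open>Optimisation over matrices and the final estimate\<close>

lemma le_RDIP:
  fixes V :: "('a::{field,finite} ^ 'n::finite) set"
  assumes "V \<in> Gamma_frob_dim q i"
  shows "int (vec.dim (D1 \<inter> V)) - int (vec.dim (D2 \<inter> V)) \<le> RDIP q i D1 D2"
  unfolding RDIP_def using assms by (intro Max_ge) auto

lemma RDIP_attained:
  fixes D1 D2 :: "('a::{field,finite} ^ 'n::finite) set"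
  assumes "Gamma_frob_dim q i \<noteq> ({} :: ('a ^ 'n) set set)"
  obtains V where "V \<in> Gamma_frob_dim q i"
    "RDIP q i D1 D2 = int (vec.dim (D1 \<inter> V)) - int (vec.dim (D2 \<inter> V))"
proof -
  have "RDIP q i D1 D2 \<in> (\<lambda>V. int (vec.dim (D1 \<inter> V)) - int (vec.dim (D2 \<inter> V))) ` Gamma_frob_dim q i"
    unfolding RDIP_def using assms by (intro Max_in) auto
  then show ?thesis using that by blast
qed

lemma finite_matrices_over: "finite (matrices_over K i :: ('a::finite ^ 'n::finite) list set)"
  by (rule finite_subset[OF _ finite_lists_length_eq[of UNIV i]]) (auto simp: matrices_over_def)

theorem proposition27:
  fixes Fq :: "'a::{field,finite} set" and q m \<mu> :: nat
    and C1 C2 :: "('a ^ 'n::finite) set"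
    and \<psi> :: "'a ^ 'l::finite \<Rightarrow> ('a ^ 'n) set"
    and M :: "'w measure" and S :: "'w \<Rightarrow> 'a ^ 'l" and X :: "'w \<Rightarrow> 'a ^ 'n"
  assumes Fq: "is_subfield Fq" "card Fq = q"
    and ext: "m \<ge> 1" "CARD('a) = q ^ m"
    and C1: "vec.subspace C1"
    and C2: "vec.subspace C2" "C2 \<subset> C1"
    and dim: "int (vec.dim C2) = int (vec.dim C1) - int CARD('l)"
    and psi: "linear_bij_quotient C1 C2 \<psi>"
    and M: "prob_space M"
    and S: "S \<in> measurable M (count_space UNIV)"
    and X: "X \<in> measurable M (count_space UNIV)"
    and SX: "AE \<omega> in M. X \<omega> \<in> \<psi> (S \<omega>)"
    and mu: "\<mu> \<le> CARD('n)"
  shows "Ent (real (q ^ m)) M S - cond_divergence_uniform (real (q ^ m)) M S X \<psi>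
           - real_of_int (RDIP q \<mu> (dual_code C2) (dual_code C1))
         \<le> universal_equivocation (real (q ^ m)) M Fq \<mu> S X
       \<and> universal_equivocation (real (q ^ m)) M Fq \<mu> S X
         \<le> real CARD('l) - real_of_int (RDIP q \<mu> (dual_code C2) (dual_code C1))
       \<and> (distr M (count_space UNIV) S = uniform_on UNIV
           \<and> distr M (count_space UNIV) X = uniform_on C1
          \<longrightarrow> universal_equivocation (real (q ^ m)) M Fq \<mu> S X
             = real CARD('l) - real_of_int (RDIP q \<mu> (dual_code C2) (dual_code C1)))"
proof -
  define b where "b = real CARD('a)"
  define H where "H B = cond_Ent b M S (\<lambda>\<omega>. rows_mult B (X \<omega>))" for B
  let ?R = "RDIP q \<mu> (dual_code C2) (dual_code C1)"
  let ?\<kappa> = "\<lambda>V. int (vec.dim (dual_code C2 \<inter> V)) - int (vec.dim (dual_code C1 \<inter> V))"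
  let ?low = "Ent b M S - cond_divergence_uniform b M S X \<psi>"
  let ?T = "matrices_over Fq \<mu> :: ('a ^ 'n) list set"
  have C2': "C2 \<subseteq> C1" and dim': "vec.dim C1 = vec.dim C2 + CARD('l)"
    using C2(2) dim by auto
  have bounds: "?low - real_of_int (?\<kappa> (vec.span (set B))) \<le> H B"
    "H B \<le> real CARD('l) - real_of_int (?\<kappa> (vec.span (set B)))" for B
    using equivocation_bounds[OF C1 C2(1) C2' dim' psi M S X SX, of B] by (simp_all add: H_def b_def)
  have dual: "dual_code C1 \<subseteq> dual_code C2" using C2' by (auto simp: dual_code_def)
  \<comment> \<open>The row space of \<open>B\<close> may have dimension below \<open>\<mu>\<close>,
    so it is first enlarged to a member of \<open>Gamma_frob_dim q \<mu>\<close>; this can only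
    increase \<open>?\<kappa>\<close>.\<close>
  have lower: "?low - real_of_int ?R \<le> H B" if B: "B \<in> ?T" for B
  proof -
    obtain V where V: "V \<in> Gamma_frob_dim q \<mu>" "vec.span (set B) \<subseteq> V"
      using rational_rows_in_Gamma_frob_dim[OF Fq(1) B mu] Fq(2) by auto
    then have "?\<kappa> (vec.span (set B)) \<le> ?\<kappa> V"
      by (intro RDIP_integrand_mono subspace_dual_code dual)
        (auto simp: Gamma_frob_dim_def Gamma_frob_def)
    also have "\<dots> \<le> ?R" using V(1) by (rule le_RDIP)
    finally show ?thesis using bounds(1)[of B] by linarith
  qed
  \<comment> \<open>The zero matrix makes the minimum range over a nonempty set; enlarging its row
    space shows the same for the maximum in \<open>RDIP\<close>.\<close>
  have "replicate \<mu> 0 \<in> ?T" using Fq(1) by (auto simp: matrices_over_def is_subfield_def)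
  then have T: "?T \<noteq> {}" and "Gamma_frob_dim q \<mu> \<noteq> ({} :: ('a ^ 'n) set set)"
    using rational_rows_in_Gamma_frob_dim[OF Fq(1) _ mu] Fq(2) by (blast, metis empty_iff)
  then obtain V where V: "V \<in> Gamma_frob_dim q \<mu>" "?R = ?\<kappa> V"
    using RDIP_attained[where ?D1.0 = "dual_code C2" and ?D2.0 = "dual_code C1"] by blast
  \<comment> \<open>A subspace attaining the RDIP is the row space of a rational matrix, and the
    upper bound for this one matrix bounds the minimum.\<close>
  then obtain B where B: "B \<in> ?T" "vec.span (set B) = V"
    using Gamma_frob_dim_rational_rows[OF Fq(1)] Fq(2) by metis
  have equiv: "universal_equivocation b M Fq \<mu> S X = Min (H ` ?T)"
    by (simp add: universal_equivocation_def H_def)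
  have fin: "finite (H ` ?T)" using finite_matrices_over by blast
  have "universal_equivocation b M Fq \<mu> S X \<le> H B"
    unfolding equiv using fin B(1) by (intro Min_le) auto
  then have le: "universal_equivocation b M Fq \<mu> S X \<le> real CARD('l) - real_of_int ?R"
    using bounds(2)[of B] B(2) V(2) by simp
  have ge: "?low - real_of_int ?R \<le> universal_equivocation b M Fq \<mu> S X"
    unfolding equiv using fin T lower by (intro Min.boundedI) auto
  \<comment> \<open>For uniform variables the entropy is \<open>CARD('l)\<close> and the divergence
    0, so the two bounds coincide.\<close>
  have "universal_equivocation b M Fq \<mu> S X = real CARD('l) - real_of_int ?R"
    if unif: "distr M (count_space UNIV) S = uniform_on UNIV" "distr M (count_space UNIV) X = uniform_on C1"
  proof -
    have "card {0, 1 :: 'a} \<le> CARD('a)" by (rule card_mono) auto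
    then have "b > 1" by (simp add: b_def)
    interpret prob_space M by (rule M)
    have info: "information_space M b" by unfold_locales fact
    have "Ent b M S = real CARD('l)"
      using info S unif(1) unfolding b_def by (rule entropy_uniform_vector)
    moreover have "cond_divergence_uniform b M S X \<psi> = 0"
      by (rule cond_divergence_uniform_eq_0[OF C1 C2(1) C2' dim' psi info S X SX unif])
    ultimately show ?thesis using le ge by simp
  qed
  moreover have "real (q ^ m) = b" by (simp add: b_def ext(2))
  ultimately show ?thesis using le ge by auto
qed

end
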